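(* Let $I$ be a finite set and $z:\mathcal P(I)\to\mathbb R$ a finite submodular function. Then the polynomial $\chi(z)(k)=\theta\circ\overline\phi(z)(k)$ equals the basic invariant $\chi_{AA}(z)(k)$.
   Context: Submodular functions. $\hat{\mathbb R}=\mathbb R\cup\{\infty\}$. A function $z:\mathcal P(I)\to\hat{\mathbb R}$ with $z(\emptyset)=0$, $z(I)<\infty$ is submodular if $z(A\cup B)+z(A\cap B)\le z(A)+z(B)$ for all $A,B\subseteq I$, and modular if equality always holds; it is finite if it does not take the value $\infty$. If $z(S)<\infty$, $z|_S$ is the restriction to $\mathcal P(S)$ and $z_{/S}(U)=z(S\cup U)-z(S)$ for $U\subseteq I\setminus S$; $z_{B/A}=(z|_B)_{/A}$. Product: $(u\cdot v)(E)=u(E\cap S)+v(E\cap T)$ for $E\subseteq S\sqcup T$. $z'$ on $C$ decomposes along $C=C_1\sqcup C_2$ if $z'(E)=z'(E\cap C_1)+z'(E\cap C_2)$ for all $E\subseteq C$. $\Pi(z)=\{x\in\mathbb RI:\sum_{i\in I}x_i=z(I),\ \sum_{i\in A}x_i\le z(A)\text{ whenever }z(A)<\infty\}$. Preorders. A preorder is a reflexive transitive relation; bubbles are classes of $x\le y\le x$; down-sets contain everything below their elements; convex subsets are $C=B\setminus A$ with $A\subseteq B$ down-sets; $C=C_1\sqcup C_2$ is a disconnected union if no element of $C_1$ is comparable to one of $C_2$; $P\preceq Q$ means $x\le_Py\Rightarrow x\le_Qy$; a totally disconnected preorder is an equivalence relation. $P$ is compatible with $z$ if $z(A)<\infty$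 for all down-sets $A$, and for down-sets $A\subseteq B$ with $B\setminus A=C_1\sqcup C_2$ a disconnected union, $z_{B/A}$ decomposes along $C_1\sqcup C_2$; then $z_{B/A}$ depends only on $C=B\setminus A$ and is written $z_C$. $P$ conforms to $z$ if moreover for convex $C$, a decomposition of $z_C$ along $C=C_1\sqcup C_2$ implies that $C=C_1\sqcup C_2$ is a disconnected union in $P$. $\mathrm{Pre}(z)$ is the set of conforming preorders, $\mathrm{minPre}(z)$ the set of its $\preceq$-minimal elements. $z_P=\prod_{C\text{ bubble}}z_C$; $z^P(A)=z(A)$ if $A$ is a down-set of $P$ and $\infty$ otherwise. $\mathrm{pre}(z)$ is the preorder whose down-sets are the $A$ with $z(A)<\infty$. Algebra. $\mathrm{SM}[I]$ (resp. $\mathrm{MOD}[I]$) is the real vector space with basis the submodular (resp. modular) functions on $I$; product $u\otimes v\mapsto u\cdot v$; coproduct $\Delta_{S,T}(z)=z|_S\otimes z_{/S}$ if $z(S)<\infty$, else $0$, for $I=S\sqcup T$, with iterates $\Delta_{S_1,\dots,S_n}$. On $\mathrm{MOD}$: $\delta(z)=\sum_{Q\in\mathrm{Pre}(z)}z_Q\otimes z^Q$, with counit equal to $1$ on $z$ if $\mathrm{pre}(z)$ is totally disconnected, $0$ otherwise. $\phi:\mathrm{SM}\to\mathrm{MOD}$, $\phi(z)=\sum_{P\in\mathrm{minPre}(z)}z^P$. Passing to isomorphism classes (bosonic Fock functor, $\bigoplus_n\mathrm{SM}[\{1,\dots,n\}]_{S_n}$, with $\Delta=\sum_{S\sqcup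 T}\Delta_{S,T}$) gives Hopf algebras $(\mathrm{SM},\mu,\Delta)$, $(\mathrm{MOD},\mu,\Delta)$, a double bialgebra $(\mathrm{MOD},\mu,\Delta,\delta)$, and an induced map $\overline\phi:\mathrm{SM}\to\mathrm{MOD}$. A double bialgebra $(B,\mu,\Delta,\delta)$ consists of bialgebras $(B,\mu,\Delta)$ and $(B,\mu,\delta)$ with $(\mathrm{id}\otimes\Delta)\delta=m_{13,2,4}(\delta\otimes\delta)\Delta$ (where $m_{13,2,4}(a\otimes b\otimes c\otimes d)=ac\otimes b\otimes d$) and $(\mathrm{id}\otimes\epsilon_\Delta)\delta=\eta\,\epsilon_\Delta$. $\mathbb R[x]$ is a double bialgebra with $\Delta(x)=1\otimes x+x\otimes 1$, $\delta(x)=x\otimes x$. By Foissy there is a unique double bialgebra morphism $\theta:\mathrm{MOD}\to\mathbb R[x]$. $\theta\circ\overline\phi(z)$ means the value on the isomorphism class of $z$. Basic invariant. The basic character on finite submodular functions is $\beta_I(z)=1$ if $\Pi(z)$ is a point and $0$ otherwise. The basic invariant $\chi_{AA}(z)$ (Aguiar–Ardila) is the polynomial with, for natural numbers $n$, $\chi_{AA}(z)(n)=\sum_{I=S_1\sqcup\cdots\sqcup S_n}(\beta_{S_1}\otimes\cdots\otimes\beta_{S_n})\circ\Delta_{S_1,\dots,S_n}(z)$, the sum being over ordered decompositions of $I$ into $n$ disjoint, possibly empty, subsets. *)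

theory Defs
  imports "HOL-Analysis.Analysis" "HOL-Analysis.Finite_Function_Topology"
    "HOL-Computational_Algebra.Polynomial"
begin

section \<open>Submodular and modular functions\<close>

text \<open>
  A function on the power set of \<open>I\<close> with values in \<open>\<real> \<union> {\<infinity>}\<close> is given by an
  \<open>ereal\<close>-valued function of which only the values on subsets of \<open>I\<close> matter; the value
  \<open>-\<infinity>\<close> is excluded. The restriction to the subsets of \<open>S\<close> is therefore given
  by the same function, together with the ground set \<open>S\<close>.
\<close>

definition submodular_on :: "'a set \<Rightarrow> ('a set \<Rightarrow> ereal) \<Rightarrow> bool" where
  "submodular_on I z \<longleftrightarrow>
     (\<forall>A\<subseteq>I. z A \<noteq> -\<infinity>) \<and> z {} = 0 \<and> z I < \<infinity> \<and>
     (\<forall>A B. A \<subseteq> I \<longrightarrow> B \<subseteq> I \<longrightarrow> z (A \<union> B) + z (A \<inter> B) \<le> z A + z B)"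

text \<open>
  Equality is required when both sides of the submodular inequality are finite, that is when
  \<open>z A\<close> and \<open>z B\<close> are. (Requiring it for all \<open>A\<close> and \<open>B\<close> would, on taking complements,
  force \<open>z\<close> to be finite, and exclude the functions \<open>z\<^sup>P\<close> below.)
\<close>

definition modular_on :: "'a set \<Rightarrow> ('a set \<Rightarrow> ereal) \<Rightarrow> bool" where
  "modular_on I z \<longleftrightarrow> submodular_on I z \<and>
     (\<forall>A B. A \<subseteq> I \<longrightarrow> B \<subseteq> I \<longrightarrow> z A < \<infinity> \<longrightarrow> z B < \<infinity> \<longrightarrow>
        z (A \<union> B) + z (A \<inter> B) = z A + z B)"

definition finite_valued :: "'a set \<Rightarrow> ('a set \<Rightarrow> ereal) \<Rightarrow> bool" where
  "finite_valued I z \<longleftrightarrow> (\<forall>A\<subseteq>I. z A < \<infinity>)"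

text \<open>The contraction \<open>z\<^sub>/\<^sub>S\<close>; on the subsets of \<open>B - A\<close>, \<open>contract z A\<close> is \<open>z\<^bsub>B/A\<^esub>\<close>.\<close>

definition contract :: "('a set \<Rightarrow> ereal) \<Rightarrow> 'a set \<Rightarrow> 'a set \<Rightarrow> ereal" where
  "contract z S = (\<lambda>U. z (S \<union> U) - z S)"

definition decomposes :: "'a set \<Rightarrow> ('a set \<Rightarrow> ereal) \<Rightarrow> 'a set \<Rightarrow> 'a set \<Rightarrow> bool" where
  "decomposes C z C1 C2 \<longleftrightarrow>
     C = C1 \<union> C2 \<and> C1 \<inter> C2 = {} \<and> (\<forall>E\<subseteq>C. z E = z (E \<inter> C1) + z (E \<inter> C2))"

text \<open>Vectors in \<open>\<real>I\<close> are represented by functions extensional on \<open>I\<close>.\<close>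

definition base_polytope :: "'a set \<Rightarrow> ('a set \<Rightarrow> ereal) \<Rightarrow> ('a \<Rightarrow> real) set" where
  "base_polytope I z = {x \<in> extensional I.
     ereal (\<Sum>i\<in>I. x i) = z I \<and>
     (\<forall>A\<subseteq>I. z A < \<infinity> \<longrightarrow> ereal (\<Sum>i\<in>A. x i) \<le> z A)}"


section \<open>Preorders and compatibility\<close>

text \<open>Here \<open>(x, y) \<in> P\<close> stands for \<open>x \<le>\<^sub>P y\<close>, so that \<open>P \<preceq> Q\<close> is \<open>P \<subseteq> Q\<close>.\<close>

definition downset :: "'a set \<Rightarrow> 'a rel \<Rightarrow> 'a set \<Rightarrow> bool" where
  "downset I P A \<longleftrightarrow> A \<subseteq> I \<and> (\<forall>x y. (x, y) \<in> P \<longrightarrow> y \<in> A \<longrightarrow> x \<in> A)"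

definition disconnected_union :: "'a rel \<Rightarrow> 'a set \<Rightarrow> 'a set \<Rightarrow> 'a set \<Rightarrow> bool" where
  "disconnected_union P C C1 C2 \<longleftrightarrow>
     C = C1 \<union> C2 \<and> C1 \<inter> C2 = {} \<and> (\<forall>x\<in>C1. \<forall>y\<in>C2. (x, y) \<notin> P \<and> (y, x) \<notin> P)"

definition bubbles :: "'a set \<Rightarrow> 'a rel \<Rightarrow> 'a set set" where
  "bubbles I P = I // (P \<inter> P\<inverse>)"

definition compatible :: "'a set \<Rightarrow> ('a set \<Rightarrow> ereal) \<Rightarrow> 'a rel \<Rightarrow> bool" where
  "compatible I z P \<longleftrightarrow>
     (\<forall>A. downset I P A \<longrightarrow> z A < \<infinity>) \<and>
     (\<forall>A B C1 C2. downset I P A \<longrightarrow> downset I P B \<longrightarrow> A \<subseteq> B \<longrightarrow>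
        disconnected_union P (B - A) C1 C2 \<longrightarrow> decomposes (B - A) (contract z A) C1 C2)"

text \<open>
  Since \<open>z\<^bsub>B/A\<^esub>\<close> depends only on the convex set \<open>C = B - A\<close> for compatible \<open>P\<close>, the
  condition on \<open>z\<^sub>C\<close> is expressed through all pairs \<open>A \<subseteq> B\<close> of down-sets.
\<close>

definition conforms :: "'a set \<Rightarrow> ('a set \<Rightarrow> ereal) \<Rightarrow> 'a rel \<Rightarrow> bool" where
  "conforms I z P \<longleftrightarrow> compatible I z P \<and>
     (\<forall>A B C1 C2. downset I P A \<longrightarrow> downset I P B \<longrightarrow> A \<subseteq> B \<longrightarrow>
        decomposes (B - A) (contract z A) C1 C2 \<longrightarrow> disconnected_union P (B - A) C1 C2)"

definition Pre :: "'a set \<Rightarrow> ('a set \<Rightarrow> ereal) \<Rightarrow> 'a rel set" where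
  "Pre I z = {P. preorder_on I P \<and> conforms I z P}"

definition minPre :: "'a set \<Rightarrow> ('a set \<Rightarrow> ereal) \<Rightarrow> 'a rel set" where
  "minPre I z = {P \<in> Pre I z. \<forall>Q\<in>Pre I z. Q \<subseteq> P \<longrightarrow> Q = P}"

text \<open>
  \<open>z\<^sub>C\<close> for convex \<open>C\<close>, computed with \<open>B\<close> the down-closure of \<open>C\<close> and \<open>A = B - C\<close>, the
  smallest of the pairs of down-sets with \<open>B - A = C\<close>.
\<close>

definition convex_minor ::
    "'a set \<Rightarrow> ('a set \<Rightarrow> ereal) \<Rightarrow> 'a rel \<Rightarrow> 'a set \<Rightarrow> 'a set \<Rightarrow> ereal" where
  "convex_minor I z P C = contract z ({x \<in> I. \<exists>c\<in>C. (x, c) \<in> P} - C)"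

text \<open>The functions \<open>z\<^sub>P\<close> and \<open>z\<^sup>P\<close>.\<close>

definition bubble_product :: "'a set \<Rightarrow> ('a set \<Rightarrow> ereal) \<Rightarrow> 'a rel \<Rightarrow> 'a set \<Rightarrow> ereal" where
  "bubble_product I z P = (\<lambda>E. \<Sum>C\<in>bubbles I P. convex_minor I z P C (E \<inter> C))"

definition downset_restrict :: "'a set \<Rightarrow> ('a set \<Rightarrow> ereal) \<Rightarrow> 'a rel \<Rightarrow> 'a set \<Rightarrow> ereal" where
  "downset_restrict I z P = (\<lambda>A. if downset I P A then z A else \<infinity>)"

definition pre :: "'a set \<Rightarrow> ('a set \<Rightarrow> ereal) \<Rightarrow> 'a rel" where
  "pre I z = (THE P. preorder_on I P \<and> (\<forall>A\<subseteq>I. downset I P A \<longleftrightarrow> z A < \<infinity>))"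


section \<open>Double bialgebra morphisms between free vector spaces\<close>

text \<open>
  The vector space with basis \<open>'b\<close> is \<open>'b \<Rightarrow>\<^sub>0 real\<close>. The tensor product of
  \<open>'b \<Rightarrow>\<^sub>0 real\<close> and \<open>'c \<Rightarrow>\<^sub>0 real\<close> is \<open>'b \<times> 'c \<Rightarrow>\<^sub>0 real\<close>, the tensor product of two basis
  vectors being the pair.
\<close>

abbreviation basis :: "'b \<Rightarrow> 'b \<Rightarrow>\<^sub>0 real" where
  "basis b \<equiv> Poly_Mapping.single b 1"

definition lin_ext :: "('b \<Rightarrow> 'v::real_vector) \<Rightarrow> ('b \<Rightarrow>\<^sub>0 real) \<Rightarrow> 'v" where
  "lin_ext f v = (\<Sum>b\<in>Poly_Mapping.keys v. Poly_Mapping.lookup v b *\<^sub>R f b)"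

definition tensor :: "('b \<Rightarrow>\<^sub>0 real) \<Rightarrow> ('c \<Rightarrow>\<^sub>0 real) \<Rightarrow> ('b \<times> 'c \<Rightarrow>\<^sub>0 real)" where
  "tensor v w = lin_ext (\<lambda>b. lin_ext (\<lambda>c. basis (b, c)) w) v"

definition tensor_map :: "(('b \<Rightarrow>\<^sub>0 real) \<Rightarrow> ('d \<Rightarrow>\<^sub>0 real)) \<Rightarrow> (('c \<Rightarrow>\<^sub>0 real) \<Rightarrow> ('e \<Rightarrow>\<^sub>0 real)) \<Rightarrow>
    ('b \<times> 'c \<Rightarrow>\<^sub>0 real) \<Rightarrow> ('d \<times> 'e \<Rightarrow>\<^sub>0 real)" where
  "tensor_map f g = lin_ext (\<lambda>(b, c). tensor (f (basis b)) (g (basis c)))"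

text \<open>
  The structure maps of a double bialgebra \<open>(B, \<mu>, \<Delta>, \<delta>)\<close> with unit \<open>\<eta> 1\<close> and counits
  \<open>\<epsilon>\<^sub>\<Delta>\<close>, \<open>\<epsilon>\<^sub>\<delta>\<close>.
\<close>

record 'b double_bialgebra =
  mu :: "('b \<times> 'b \<Rightarrow>\<^sub>0 real) \<Rightarrow> ('b \<Rightarrow>\<^sub>0 real)"
  unit :: "'b \<Rightarrow>\<^sub>0 real"
  Delta :: "('b \<Rightarrow>\<^sub>0 real) \<Rightarrow> ('b \<times> 'b \<Rightarrow>\<^sub>0 real)"
  eps_Delta :: "('b \<Rightarrow>\<^sub>0 real) \<Rightarrow> real"
  delta :: "('b \<Rightarrow>\<^sub>0 real) \<Rightarrow> ('b \<times> 'b \<Rightarrow>\<^sub>0 real)"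
  eps_delta :: "('b \<Rightarrow>\<^sub>0 real) \<Rightarrow> real"

definition double_bialgebra_hom ::
    "'b double_bialgebra \<Rightarrow> 'c double_bialgebra \<Rightarrow> (('b \<Rightarrow>\<^sub>0 real) \<Rightarrow> ('c \<Rightarrow>\<^sub>0 real)) \<Rightarrow> bool" where
  "double_bialgebra_hom A B f \<longleftrightarrow>
     linear f \<and>
     f (unit A) = unit B \<and>
     (\<forall>w. f (mu A w) = mu B (tensor_map f f w)) \<and>
     (\<forall>v. Delta B (f v) = tensor_map f f (Delta A v)) \<and>
     (\<forall>v. eps_Delta B (f v) = eps_Delta A v) \<and>
     (\<forall>v. delta B (f v) = tensor_map f f (delta A v)) \<and>
     (\<forall>v. eps_delta B (f v) = eps_delta A v)"


section \<open>The double bialgebra of polynomials\<close>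

text \<open>
  \<open>\<real>[x]\<close> is the monoid algebra \<open>nat \<Rightarrow>\<^sub>0 real\<close>, with \<open>basis n\<close> standing for \<open>x ^ n\<close>. Likewise
  \<open>nat \<times> nat \<Rightarrow>\<^sub>0 real\<close> is the algebra \<open>\<real>[x] \<otimes> \<real>[x]\<close>, in which \<open>\<Delta>\<close> and \<open>\<delta>\<close> are the algebra
  morphisms with the given values at \<open>x\<close>.
\<close>

definition to_poly :: "(nat \<Rightarrow>\<^sub>0 real) \<Rightarrow> real poly" where
  "to_poly p = (\<Sum>n\<in>Poly_Mapping.keys p. monom (Poly_Mapping.lookup p n) n)"

definition poly_double_bialgebra :: "nat double_bialgebra" where
  "poly_double_bialgebra = \<lparr>
     mu = lin_ext (\<lambda>(m, n). basis m * basis n),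
     unit = 1,
     Delta = lin_ext (\<lambda>n. (tensor 1 (basis 1) + tensor (basis 1) 1) ^ n),
     eps_Delta = (\<lambda>p. poly (to_poly p) 0),
     delta = lin_ext (\<lambda>n. (tensor (basis 1) (basis 1)) ^ n),
     eps_delta = (\<lambda>p. poly (to_poly p) 1)\<rparr>"


section \<open>Isomorphism classes\<close>

text \<open>
  The isomorphism class of a function on the subsets of a finite set \<open>I\<close> with \<open>n\<close> elements is
  the orbit under the symmetric group of the functions it induces on the subsets of \<open>{1..n}\<close>.
  The coinvariants of the vector space with basis the functions on the subsets of \<open>{1..n}\<close> have
  these orbits as a basis, so that the classes of all \<open>n\<close> form a basis of the value of the
  bosonic Fock functor.
\<close>

definition iso_class :: "'a set \<Rightarrow> ('a set \<Rightarrow> ereal) \<Rightarrow> (nat \<times> (nat set \<Rightarrow> ereal)) set" where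
  "iso_class I z =
     {(n, restrict (\<lambda>A. z (\<sigma> ` A)) (Pow {1..n})) | n \<sigma>. bij_betw \<sigma> {1..n} I}"

typedef submodular_class =
  "{iso_class {1..n} z | (n::nat) z. submodular_on {1..n} z}"
proof -
  have "submodular_on {1..(0::nat)} (\<lambda>_. 0)"
    by (simp add: submodular_on_def)
  then show ?thesis
    by blast
qed

typedef modular_class =
  "{iso_class {1..n} z | (n::nat) z. modular_on {1..n} z}"
proof -
  have "modular_on {1..(0::nat)} (\<lambda>_. 0)"
    by (simp add: modular_on_def submodular_on_def)
  then show ?thesis
    by blast
qed

type_synonym SM = "submodular_class \<Rightarrow>\<^sub>0 real"
type_synonym MOD = "modular_class \<Rightarrow>\<^sub>0 real"

text \<open>The basis vectors of \<open>SM\<close> and \<open>MOD\<close> given by functions on any finite ground set.\<close>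

definition sm_vec :: "'a set \<Rightarrow> ('a set \<Rightarrow> ereal) \<Rightarrow> SM" where
  "sm_vec I z = basis (Abs_submodular_class (iso_class I z))"

definition mod_vec :: "'a set \<Rightarrow> ('a set \<Rightarrow> ereal) \<Rightarrow> MOD" where
  "mod_vec I z = basis (Abs_modular_class (iso_class I z))"

text \<open>
  Operations equivariant under bijections of ground sets are transported to isomorphism classes
  by applying them to an arbitrary representative.
\<close>

definition sm_rep :: "submodular_class \<Rightarrow> nat \<times> (nat set \<Rightarrow> ereal)" where
  "sm_rep c = (SOME p. p \<in> Rep_submodular_class c)"

definition mod_rep :: "modular_class \<Rightarrow> nat \<times> (nat set \<Rightarrow> ereal)" where
  "mod_rep c = (SOME p. p \<in> Rep_modular_class c)"

definition on_sm :: "(nat set \<Rightarrow> (nat set \<Rightarrow> ereal) \<Rightarrow> 'v::real_vector) \<Rightarrow> SM \<Rightarrow> 'v" where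
  "on_sm F = lin_ext (\<lambda>c. case sm_rep c of (n, z) \<Rightarrow> F {1..n} z)"

definition on_mod :: "(nat set \<Rightarrow> (nat set \<Rightarrow> ereal) \<Rightarrow> 'v::real_vector) \<Rightarrow> MOD \<Rightarrow> 'v" where
  "on_mod F = lin_ext (\<lambda>c. case mod_rep c of (n, z) \<Rightarrow> F {1..n} z)"

text \<open>The product of functions on the disjoint ground sets \<open>Inl ` I\<close> and \<open>Inr ` J\<close>.\<close>

definition mod_mult :: "MOD \<Rightarrow> MOD \<Rightarrow> MOD" where
  "mod_mult v w =
     on_mod (\<lambda>I u. on_mod (\<lambda>J u'. mod_vec (I <+> J) (\<lambda>E. u (Inl -` E) + u' (Inr -` E))) w) v"

definition MOD_double_bialgebra :: "modular_class double_bialgebra" where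
  "MOD_double_bialgebra = \<lparr>
     mu = lin_ext (\<lambda>(b, c). mod_mult (basis b) (basis c)),
     unit = mod_vec ({} :: nat set) (\<lambda>_. 0),
     Delta = on_mod (\<lambda>I z. \<Sum>S\<in>Pow I.
       if z S < \<infinity> then tensor (mod_vec S z) (mod_vec (I - S) (contract z S)) else 0),
     eps_Delta = on_mod (\<lambda>I z. if I = {} then 1 else 0),
     delta = on_mod (\<lambda>I z. \<Sum>Q\<in>Pre I z.
       tensor (mod_vec I (bubble_product I z Q)) (mod_vec I (downset_restrict I z Q))),
     eps_delta = on_mod (\<lambda>I z. if equiv I (pre I z) then 1 else 0)\<rparr>"

text \<open>The map \<open>\<phi>\<close> on isomorphism classes.\<close>

definition phi_bar :: "SM \<Rightarrow> MOD" where
  "phi_bar = on_sm (\<lambda>I z. \<Sum>P\<in>minPre I z. mod_vec I (downset_restrict I z P))"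


section \<open>The basic invariant\<close>

definition basic_character :: "'a set \<Rightarrow> ('a set \<Rightarrow> ereal) \<Rightarrow> real" where
  "basic_character I z = (if is_singleton (base_polytope I z) then 1 else 0)"

text \<open>
  The value of \<open>(\<beta> \<otimes> \<dots> \<otimes> \<beta>) \<circ> \<Delta>\<close> at \<open>z\<close>, for the iterated coproduct \<open>\<Delta>\<close> given by a list
  of subsets \<open>S\<^sub>1, \<dots>, S\<^sub>n\<close>, through
  \<open>\<Delta>(S\<^sub>1, \<dots>, S\<^sub>n) = (id \<otimes> \<Delta>(S\<^sub>2, \<dots>, S\<^sub>n)) \<circ> \<Delta>(S\<^sub>1, S\<^sub>2 \<union> \<dots> \<union> S\<^sub>n)\<close>.
\<close>

fun basic_on_coproduct :: "'a set list \<Rightarrow> ('a set \<Rightarrow> ereal) \<Rightarrow> real" where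
  "basic_on_coproduct [] z = 1"
| "basic_on_coproduct (S # Ss) z =
     (if z S < \<infinity> then basic_character S z * basic_on_coproduct Ss (contract z S) else 0)"

definition ordered_decompositions :: "'a set \<Rightarrow> nat \<Rightarrow> 'a set list set" where
  "ordered_decompositions I n = {Ss. length Ss = n \<and> \<Union> (set Ss) = I \<and>
     (\<forall>i<n. \<forall>j<n. i \<noteq> j \<longrightarrow> Ss ! i \<inter> Ss ! j = {})}"

definition chi_AA :: "'a set \<Rightarrow> ('a set \<Rightarrow> ereal) \<Rightarrow> real poly" where
  "chi_AA I z = (THE p. \<forall>n::nat. poly p (of_nat n) =
     (\<Sum>Ss\<in>ordered_decompositions I n. basic_on_coproduct Ss z))"

end

theory Submission
  imports Defs
begin

text \<open>
  The morphism \<open>\<theta>\<close> is determined by its values at natural numbers. On \<open>\<real>[x]\<close> the counits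
  \<open>\<epsilon>\<^sub>\<Delta>\<close> and \<open>\<epsilon>\<^sub>\<delta>\<close> are evaluation at \<open>0\<close> and \<open>1\<close>, and \<open>\<Delta>\<close> is the substitution of
  \<open>s + t\<close> for \<open>x\<close>; hence \<open>\<theta> v\<close> at \<open>n + 1\<close> is \<open>\<epsilon>\<^sub>\<delta>\<close> tensored with the value of \<open>\<theta>\<close> at \<open>n\<close>,
  applied to \<open>\<Delta> v\<close> (\<open>evaluate_hom_add\<close>). For the modular function \<open>z\<^sup>P\<close> this recursion counts
  the ordered decompositions of \<open>I\<close> whose initial unions are down-sets of \<open>P\<close> and on whose blocks
  \<open>P\<close> is an equivalence relation (\<open>evaluate_downset_vec\<close>).

  The preorders over which \<open>\<phi>\<close> sums have a geometric meaning. The sets \<open>A\<close> on which a point \<open>x\<close> of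
  the base polytope is tight, \<open>x(A) = z(A)\<close>, are closed under unions and intersections by
  submodularity, so they are the down-sets of a preorder, and this preorder conforms to \<open>z\<close>. It
  is antisymmetric exactly when the tight sets determine \<open>x\<close>, that is, at the vertices of the
  polytope, and the minimal conforming preorders are the preorders of the vertices
  (\<open>bij_betw_vertices_minPre\<close>). If \<open>P\<close> comes from the vertex \<open>x\<close>, then \<open>z\<^sup>P\<close> is \<open>A \<mapsto> x(A)\<close> on the
  down-sets of \<open>P\<close>.

  Fix an ordered decomposition. It is counted for the vertex \<open>x\<close> if and only if every minor of \<open>z\<close>
  along the decomposition coincides with \<open>x\<close> (\<open>graded_by_iff_additive_along\<close>). Conversely, any \<open>x\<close>
  with this property is a vertex (\<open>additive_along_vertex\<close>), there is at most one, and there is one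
  exactly when all the minors are modular, which is when all their base polytopes are points
  (\<open>basic_on_coproduct_eq\<close>). So the number of pairs of a vertex and a decomposition counted for
  it is the sum that defines the basic invariant (\<open>sum_vertices_graded_by\<close>). Geometrically, an
  ordered decomposition is a linear functional, which attains its maximum on a face of the base
  polytope, and this face is the product of the base polytopes of the minors; the vertex \<open>x\<close> is
  the one that the face reduces to when all of these are points.
\<close>

section \<open>Tight sets of a submodular function\<close>

lemma subset_of_downsets:
  assumes "preorder_on I P" "preorder_on I Q" "\<And>A. downset I P A \<Longrightarrow> downset I Q A"
  shows "Q \<subseteq> P"
proof (clarify)
  fix a b assume ab: "(a, b) \<in> Q"
  have "downset I P {c. (c, b) \<in> P}"
    using assms(1) unfolding downset_def preorder_on_def by (blast dest: transD)
  then have "downset I Q {c. (c, b) \<in> P}" by (rule assms(3))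
  moreover have "(b, b) \<in> P" using assms ab unfolding preorder_on_def refl_on_def by auto
  ultimately show "(a, b) \<in> P" using ab unfolding downset_def by blast
qed

lemma downset_mono: "Q \<subseteq> P \<Longrightarrow> downset I P A \<Longrightarrow> downset I Q A"
  unfolding downset_def by blast

text \<open>
  The ground set is carried along because restriction and contraction change it, and \<open>r\<close> is the
  real-valued version of \<open>z\<close>, in which arithmetic can be done without \<open>\<infinity>\<close>.
\<close>

locale finite_submodular =
  fixes I :: "'a set" and z :: "'a set \<Rightarrow> ereal" and r :: "'a set \<Rightarrow> real"
  assumes finite_ground: "finite I"
    and val: "A \<subseteq> I \<Longrightarrow> z A = ereal (r A)"
    and empty: "r {} = 0"
    and submodular: "A \<subseteq> I \<Longrightarrow> B \<subseteq> I \<Longrightarrow> r (A \<union> B) + r (A \<inter> B) \<le> r A + r B"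

lemma finite_submodular_real_of_ereal:
  assumes "finite I" "submodular_on I z" "finite_valued I z"
  shows "finite_submodular I z (\<lambda>A. real_of_ereal (z A))"
proof
  have v: "z A = ereal (real_of_ereal (z A))" if "A \<subseteq> I" for A
  proof -
    have "z A \<noteq> \<infinity>" "z A \<noteq> -\<infinity>"
      using assms that by (auto simp: submodular_on_def finite_valued_def)
    then show ?thesis by (cases "z A") auto
  qed
  show "finite I" by fact
  show "z A = ereal (real_of_ereal (z A))" if "A \<subseteq> I" for A
    using v[OF that] .
  show "real_of_ereal (z {}) = 0" using assms by (simp add: submodular_on_def)
  fix A B assume AB: "A \<subseteq> I" "B \<subseteq> I"
  have "z (A \<union> B) + z (A \<inter> B) \<le> z A + z B"
    using assms AB by (auto simp: submodular_on_def)
  moreover have "A \<union> B \<subseteq> I" "A \<inter> B \<subseteq> I" using AB by auto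
  ultimately have "ereal (real_of_ereal (z (A \<union> B))) + ereal (real_of_ereal (z (A \<inter> B)))
      \<le> ereal (real_of_ereal (z A)) + ereal (real_of_ereal (z B))"
    using v AB by metis
  then show "real_of_ereal (z (A \<union> B)) + real_of_ereal (z (A \<inter> B))
      \<le> real_of_ereal (z A) + real_of_ereal (z B)"
    by simp
qed

context finite_submodular
begin

lemma finite_sub [simp]: "A \<subseteq> I \<Longrightarrow> finite A"
  using finite_ground finite_subset by blast

lemma restriction:
  assumes "S \<subseteq> I"
  shows "finite_submodular S z r"
  using assms val empty submodular by unfold_locales (auto simp: subset_trans)

lemma contract_val:
  assumes "S \<subseteq> I" "E \<subseteq> I"
  shows "contract z S E = ereal (r (S \<union> E) - r S)"
  using assms by (simp add: contract_def val)

lemma contraction: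
  assumes "S \<subseteq> I"
  shows "finite_submodular (I - S) (contract z S) (\<lambda>A. r (S \<union> A) - r S)"
proof
  show "finite (I - S)" using finite_ground by simp
  show "contract z S A = ereal (r (S \<union> A) - r S)" if "A \<subseteq> I - S" for A
    using contract_val[OF assms, of A] that by blast
  show "r (S \<union> {}) - r S = 0" by simp
  fix A B assume AB: "A \<subseteq> I - S" "B \<subseteq> I - S"
  have "r ((S \<union> A) \<union> (S \<union> B)) + r ((S \<union> A) \<inter> (S \<union> B)) \<le> r (S \<union> A) + r (S \<union> B)"
    using AB assms by (intro submodular) auto
  moreover have "(S \<union> A) \<union> (S \<union> B) = S \<union> (A \<union> B)" "(S \<union> A) \<inter> (S \<union> B) = S \<union> (A \<inter> B)"
    by auto
  ultimately show "r (S \<union> (A \<union> B)) - r S + (r (S \<union> (A \<inter> B)) - r S)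
      \<le> r (S \<union> A) - r S + (r (S \<union> B) - r S)" by simp
qed

definition dominated :: "'a set \<Rightarrow> ('a \<Rightarrow> real) \<Rightarrow> bool" where
  "dominated U x \<longleftrightarrow> (\<forall>A\<subseteq>U. sum x A \<le> r A)"

definition tight :: "('a \<Rightarrow> real) \<Rightarrow> 'a set \<Rightarrow> bool" where
  "tight x A \<longleftrightarrow> A \<subseteq> I \<and> sum x A = r A"

text \<open>
  On the whole ground set and for a point \<open>x\<close> of the base polytope, this is the combinatorial form
  of being a vertex: the tight sets then contain a flag, and the values of \<open>x\<close> are the successive
  differences of \<open>r\<close> along it.
\<close>

definition separated :: "'a set \<Rightarrow> ('a \<Rightarrow> real) \<Rightarrow> bool" where
  "separated U x \<longleftrightarrow> (\<forall>a\<in>U. \<forall>b\<in>U. a \<noteq> b \<longrightarrow> (\<exists>A\<subseteq>U. tight x A \<and> (a \<in> A) \<noteq> (b \<in> A)))"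

definition tight_preorder :: "('a \<Rightarrow> real) \<Rightarrow> 'a rel" where
  "tight_preorder x = {(a, b). a \<in> I \<and> b \<in> I \<and> (\<forall>A. tight x A \<longrightarrow> b \<in> A \<longrightarrow> a \<in> A)}"

lemma base_polytope_iff:
  "x \<in> base_polytope I z \<longleftrightarrow> x \<in> extensional I \<and> tight x I \<and> dominated I x"
proof -
  have "(\<forall>A\<subseteq>I. z A < \<infinity> \<longrightarrow> ereal (sum x A) \<le> z A) \<longleftrightarrow> (\<forall>A\<subseteq>I. sum x A \<le> r A)"
    using val by auto
  then show ?thesis
    unfolding base_polytope_def tight_def dominated_def using val[of I] by auto
qed

lemma tight_cong: "(\<And>a. a \<in> A \<Longrightarrow> x a = y a) \<Longrightarrow> tight x A \<longleftrightarrow> tight y A"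
  unfolding tight_def using sum.cong[of A A x y] by auto

text \<open>
  One step of the greedy algorithm: the new coordinate is chosen to make \<open>insert a U\<close> tight. The
  bounds persist because the marginal value of \<open>a\<close> decreases as the set to which it is added grows.
\<close>

lemma extend_insert:
  assumes "U \<subseteq> I" "a \<in> I" "a \<notin> U" "dominated U x" "tight x U" "separated U x"
  defines "x' \<equiv> x(a := r (insert a U) - r U)"
  shows "dominated (insert a U) x'" "tight x' (insert a U)" "separated (insert a U) x'"
proof -
  have eq: "sum x' A = sum x A" if "A \<subseteq> U" for A
    using that assms(3) unfolding x'_def by (intro sum.cong) auto
  have fU: "finite U" using assms(1) by simp
  have sU: "sum x U = r U" using assms(5) by (simp add: tight_def)
  show T: "tight x' (insert a U)"
    using assms(1-3) fU sU eq[of U] by (simp add: tight_def x'_def)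
  have teq: "tight x' A \<longleftrightarrow> tight x A" if "A \<subseteq> U" for A
    using eq[OF that] by (simp add: tight_def)
  show "dominated (insert a U) x'"
    unfolding dominated_def
  proof (intro allI impI)
    fix A assume A: "A \<subseteq> insert a U"
    show "sum x' A \<le> r A"
    proof (cases "a \<in> A")
      case False
      then have "A \<subseteq> U" using A by auto
      then show ?thesis using eq assms(4) by (simp add: dominated_def)
    next
      case True
      define B where "B = A - {a}"
      have B: "B \<subseteq> U" "A = insert a B" "a \<notin> B" using True A B_def by auto
      have fB: "finite B" using B fU finite_subset by blast
      have "sum x' A = (r (insert a U) - r U) + sum x B"
        using B fB eq[of B] by (simp add: x'_def)
      also have "\<dots> \<le> (r (insert a U) - r U) + r B"
        using assms(4) B by (simp add: dominated_def)
      also have "\<dots> \<le> r A"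
      proof -
        have "r (A \<union> U) + r (A \<inter> U) \<le> r A + r U"
          using B assms(1,2) by (intro submodular) auto
        moreover have "A \<union> U = insert a U" "A \<inter> U = B" using B assms(3) by auto
        ultimately show ?thesis by simp
      qed
      finally show ?thesis .
    qed
  qed
  show "separated (insert a U) x'"
    unfolding separated_def
  proof (intro ballI impI)
    fix b c assume bc: "b \<in> insert a U" "c \<in> insert a U" "b \<noteq> c"
    show "\<exists>A\<subseteq>insert a U. tight x' A \<and> (b \<in> A) \<noteq> (c \<in> A)"
    proof (cases "b = a \<or> c = a")
      case True
      have "tight x' U" using teq[of U] assms(5) by simp
      then show ?thesis using True bc assms(3) by blast
    next
      case False
      then obtain A where "A \<subseteq> U" "tight x A" "(b \<in> A) \<noteq> (c \<in> A)"
        using assms(6) bc unfolding separated_def by blast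
      then show ?thesis using teq by blast
    qed
  qed
qed

lemma extend_union:
  assumes "finite M" "M \<subseteq> I - U" "U \<subseteq> I" "dominated U x" "tight x U" "separated U x"
  shows "\<exists>x'. (\<forall>b\<in>U. x' b = x b) \<and> dominated (U \<union> M) x' \<and> tight x' (U \<union> M) \<and> separated (U \<union> M) x'"
  using assms(1,2)
proof induction
  case empty
  show ?case using assms by auto
next
  case (insert a M)
  then obtain x' where x': "\<forall>b\<in>U. x' b = x b" "dominated (U \<union> M) x'" "tight x' (U \<union> M)"
    "separated (U \<union> M) x'" by auto
  have "U \<union> M \<subseteq> I" "a \<in> I" "a \<notin> U \<union> M" using insert assms by auto
  from extend_insert[OF this x'(2-4)] show ?case
    using x'(1) \<open>a \<notin> U \<union> M\<close>
    by (intro exI[of _ "x'(a := r (insert a (U \<union> M)) - r (U \<union> M))"])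
      (auto simp del: fun_upd_apply, auto)
qed

text \<open>
  A maximal chain of \<open>D\<close> is refined to a flag, along which the greedy algorithm is run. That all of
  \<open>D\<close>, and not only the chain, becomes tight comes from modularity: if \<open>V\<close> is maximal among the
  members properly below \<open>U\<close>, then any \<open>A \<in> D\<close> inside \<open>U\<close> but not inside \<open>V\<close> has \<open>A \<union> V = U\<close>, which
  expresses \<open>r A\<close> through sets already known to be tight.
\<close>

lemma exists_tight_on_lattice:
  assumes D: "D \<subseteq> Pow I" "{} \<in> D"
    and closed: "\<And>A B. A \<in> D \<Longrightarrow> B \<in> D \<Longrightarrow> A \<union> B \<in> D \<and> A \<inter> B \<in> D"
    and modular: "\<And>A B. A \<in> D \<Longrightarrow> B \<in> D \<Longrightarrow> r (A \<union> B) + r (A \<inter> B) = r A + r B"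
    and "U \<in> D"
  shows "\<exists>x. dominated U x \<and> (\<forall>A\<in>D. A \<subseteq> U \<longrightarrow> tight x A) \<and> separated U x"
  using \<open>U \<in> D\<close>
proof (induction "card U" arbitrary: U rule: less_induct)
  case less
  show ?case
  proof (cases "U = {}")
    case True
    then show ?thesis
      by (auto simp: dominated_def separated_def tight_def empty)
  next
    case False
    \<comment> \<open>\<open>V\<close> is the member of \<open>D\<close> just below \<open>U\<close> in a maximal chain.\<close>
    define E where "E = {A \<in> D. A \<subset> U}"
    have "finite E" using D(1) finite_ground
      by (intro finite_subset[of E "Pow I"]) (auto simp: E_def)
    moreover have "E \<noteq> {}" using False D(2) E_def by auto
    ultimately obtain V where V: "V \<in> E" "\<forall>W\<in>E. V \<subseteq> W \<longrightarrow> W = V"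
      using finite_has_maximal[of E] by auto
    have UI: "U \<subseteq> I" using less.prems D by auto
    have VD: "V \<in> D" "V \<subset> U" using V E_def by auto
    have "card V < card U" using VD UI finite_sub psubset_card_mono by metis
    from less.hyps[OF this VD(1)] obtain x where
      x: "dominated V x" "\<forall>A\<in>D. A \<subseteq> V \<longrightarrow> tight x A" "separated V x" by blast
    have "\<exists>x'. (\<forall>b\<in>V. x' b = x b) \<and> dominated (V \<union> (U - V)) x' \<and> tight x' (V \<union> (U - V)) \<and>
        separated (V \<union> (U - V)) x'"
      using x VD UI by (intro extend_union) auto
    moreover have "V \<union> (U - V) = U" using VD by auto
    ultimately obtain x' where x': "\<forall>b\<in>V. x' b = x b" "dominated U x'" "tight x' U" "separated U x'"
      by auto
    have "tight x' A" if A: "A \<in> D" "A \<subseteq> U" for A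
    proof -
      have sub: "tight x' B" if "B \<in> D" "B \<subseteq> V" for B
        using x(2) x'(1) that tight_cong[of B x' x] by (metis subsetD)
      show ?thesis
      proof (cases "A \<subseteq> V")
        case True
        then show ?thesis using sub A by blast
      next
        case False
        have "A \<union> V \<in> D" using closed A VD by blast
        \<comment> \<open>\<open>A \<union> V\<close> lies in \<open>D\<close> between \<open>V\<close> and \<open>U\<close> and is not \<open>V\<close>.\<close>
        then have AV: "A \<union> V = U" using V(2) False A VD unfolding E_def by blast
        have "sum x' (A \<union> V) + sum x' (A \<inter> V) = sum x' A + sum x' V"
          using A UI VD by (intro sum.union_inter) (auto intro: finite_sub)
        moreover have "r (A \<union> V) + r (A \<inter> V) = r A + r V" using modular A VD by blast
        moreover have "tight x' (A \<inter> V)" "tight x' V" using sub closed A VD by auto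
        ultimately show ?thesis using x'(3) AV A UI unfolding tight_def by auto
      qed
    qed
    then show ?thesis using x' by blast
  qed
qed

lemma tight_union_inter:
  assumes "dominated I x" "tight x A" "tight x B"
  shows "tight x (A \<union> B)" "tight x (A \<inter> B)"
proof -
  have AB: "A \<subseteq> I" "B \<subseteq> I" using assms by (auto simp: tight_def)
  have "sum x (A \<union> B) + sum x (A \<inter> B) = sum x A + sum x B"
    using AB by (intro sum.union_inter) auto
  moreover have "r (A \<union> B) + r (A \<inter> B) \<le> r A + r B" using AB by (rule submodular)
  moreover have "sum x (A \<union> B) \<le> r (A \<union> B)" "sum x (A \<inter> B) \<le> r (A \<inter> B)"
    using assms(1) AB unfolding dominated_def by blast+
  ultimately show "tight x (A \<union> B)" "tight x (A \<inter> B)"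
    using assms AB unfolding tight_def by auto
qed

lemma preorder_tight_preorder: "preorder_on I (tight_preorder x)"
  unfolding preorder_on_def refl_on_def trans_def tight_preorder_def by blast

text \<open>
  A finite family of sets closed under unions and intersections consists of the down-sets of a
  preorder: a down-set is the union of the smallest tight sets \<open>T b\<close> around its elements \<open>b\<close>.
\<close>

lemma downset_tight_preorder:
  assumes "dominated I x" "tight x I"
  shows "downset I (tight_preorder x) A \<longleftrightarrow> tight x A"
proof
  assume "tight x A"
  then show "downset I (tight_preorder x) A"
    unfolding downset_def tight_preorder_def by (auto simp: tight_def)
next
  assume A: "downset I (tight_preorder x) A"
  define T where "T b = \<Inter>{B. tight x B \<and> b \<in> B}" for b
  have finT: "finite {B. tight x B}"
    by (rule finite_subset[of _ "Pow I"]) (auto simp: tight_def finite_ground)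
  have inter: "tight x (\<Inter>F)" if "finite F" "F \<noteq> {}" "\<forall>B\<in>F. tight x B" for F
    using that by (induction rule: finite_ne_induct) (auto intro: tight_union_inter[OF assms(1)])
  have union: "tight x (\<Union>F)" if "finite F" "\<forall>B\<in>F. tight x B" for F
    using that
    by (induction rule: finite_induct)
      (auto intro: tight_union_inter[OF assms(1)] simp: tight_def[of x "{}"] empty)
  have tT: "tight x (T b)" if "b \<in> I" for b
    unfolding T_def using finT assms(2) that by (intro inter) (auto intro: finite_subset[OF _ finT])
  have AI: "A \<subseteq> I" using A by (simp add: downset_def)
  have "T b \<subseteq> A" if "b \<in> A" for b
  proof
    fix a assume a: "a \<in> T b"
    have "(a, b) \<in> tight_preorder x"
      using a that AI tT[of b] unfolding tight_preorder_def T_def tight_def by blast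
    then show "a \<in> A" using A that unfolding downset_def by blast
  qed
  moreover have "b \<in> T b" for b unfolding T_def by auto
  ultimately have "A = \<Union>(T ` A)" by blast
  moreover have "tight x (\<Union>(T ` A))"
    using tT AI by (intro union) auto
  ultimately show "tight x A" by simp
qed

lemma tight_contract:
  assumes "dominated I x" "tight x A" "A \<subseteq> B" "B \<subseteq> I" "E \<subseteq> B - A"
  shows "sum x E \<le> r (A \<union> E) - r A" "tight x (A \<union> E) \<longleftrightarrow> sum x E = r (A \<union> E) - r A"
proof -
  have "A \<union> E \<subseteq> I" using assms by auto
  then have "sum x (A \<union> E) \<le> r (A \<union> E)" using assms(1) unfolding dominated_def by blast
  moreover have "sum x (A \<union> E) = sum x A + sum x E"
    using assms by (intro sum.union_disjoint) (auto intro: finite_sub)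
  ultimately show "sum x E \<le> r (A \<union> E) - r A" "tight x (A \<union> E) \<longleftrightarrow> sum x E = r (A \<union> E) - r A"
    using assms \<open>A \<union> E \<subseteq> I\<close> unfolding tight_def by auto
qed

text \<open>
  The inequality \<open>r E \<le> r (E \<inter> C1) + r (E \<inter> C2)\<close> is submodularity; the reverse inequality
  follows from the single equation for \<open>C\<close>, by submodularity for the pairs \<open>E, C1\<close> and
  \<open>E \<union> C1, C2\<close>.
\<close>

lemma decomposes_iff:
  assumes "C = C1 \<union> C2" "C1 \<inter> C2 = {}" "C \<subseteq> I"
  shows "decomposes C z C1 C2 \<longleftrightarrow> r C = r C1 + r C2"
proof
  assume "decomposes C z C1 C2"
  then have "z C = z (C \<inter> C1) + z (C \<inter> C2)" unfolding decomposes_def by blast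
  moreover have "C \<inter> C1 = C1" "C \<inter> C2 = C2" using assms by auto
  moreover have "C1 \<subseteq> I" "C2 \<subseteq> I" using assms by auto
  ultimately show "r C = r C1 + r C2" using assms by (simp add: val)
next
  assume eq: "r C = r C1 + r C2"
  have "r E = r (E \<inter> C1) + r (E \<inter> C2)" if "E \<subseteq> C" for E
  proof -
    have sub: "E \<subseteq> I" "C1 \<subseteq> I" "C2 \<subseteq> I" using that assms by auto
    have "r ((E \<inter> C1) \<union> (E \<inter> C2)) + r ((E \<inter> C1) \<inter> (E \<inter> C2)) \<le> r (E \<inter> C1) + r (E \<inter> C2)"
      using sub by (intro submodular) auto
    moreover have "(E \<inter> C1) \<union> (E \<inter> C2) = E" "(E \<inter> C1) \<inter> (E \<inter> C2) = {}" using that assms by auto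
    ultimately have 1: "r E \<le> r (E \<inter> C1) + r (E \<inter> C2)" by (simp add: empty)
    have 2: "r (E \<union> C1) + r (E \<inter> C1) \<le> r E + r C1" using sub by (intro submodular)
    have "r ((E \<union> C1) \<union> C2) + r ((E \<union> C1) \<inter> C2) \<le> r (E \<union> C1) + r C2"
      using sub by (intro submodular) auto
    moreover have "(E \<union> C1) \<union> C2 = C" "(E \<union> C1) \<inter> C2 = E \<inter> C2" using that assms by auto
    ultimately have 3: "r C + r (E \<inter> C2) \<le> r (E \<union> C1) + r C2" by simp
    show ?thesis using 1 2 3 eq by linarith
  qed
  moreover have "E \<subseteq> I" "E \<inter> C1 \<subseteq> I" "E \<inter> C2 \<subseteq> I" if "E \<subseteq> C" for E
    using that assms(3) by auto
  ultimately have "z E = z (E \<inter> C1) + z (E \<inter> C2)" if "E \<subseteq> C" for E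
    using that val by (metis plus_ereal.simps(1))
  then show "decomposes C z C1 C2" using assms unfolding decomposes_def by blast
qed

lemma decomposes_contract_iff:
  assumes "B - A = C1 \<union> C2" "C1 \<inter> C2 = {}" "A \<subseteq> B" "B \<subseteq> I"
  shows "decomposes (B - A) (contract z A) C1 C2 \<longleftrightarrow> r B + r A = r (A \<union> C1) + r (A \<union> C2)"
proof -
  have "A \<subseteq> I" "B - A \<subseteq> I - A" "A \<union> (B - A) = B" using assms by auto
  then show ?thesis
    using finite_submodular.decomposes_iff[OF contraction, of A "B - A" C1 C2] assms by auto
qed

section \<open>Vertices and minimal conforming preorders\<close>

text \<open>
  Both sides of the conformity condition for \<open>C1\<close> and \<open>C2\<close> say that \<open>A \<union> C1\<close> and \<open>A \<union> C2\<close>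
  are tight: a decomposition of \<open>z\<^bsub>B/A\<^esub>\<close> forces equality in the bounds for \<open>x\<close> on the two parts,
  since \<open>x\<close> is additive and \<open>A\<close> and \<open>B\<close> are tight; a disconnected union means that both sets are
  down-sets.
\<close>

lemma tight_preorder_in_Pre:
  assumes "dominated I x" "tight x I"
  shows "tight_preorder x \<in> Pre I z"
proof -
  let ?P = "tight_preorder x"
  note down = downset_tight_preorder[OF assms]
  have key: "decomposes (B - A) (contract z A) C1 C2 \<longleftrightarrow> disconnected_union ?P (B - A) C1 C2"
    if A: "downset I ?P A" and B: "downset I ?P B" and AB: "A \<subseteq> B" for A B C1 C2
  proof (cases "B - A = C1 \<union> C2 \<and> C1 \<inter> C2 = {}")
    case False
    then show ?thesis unfolding decomposes_def disconnected_union_def by blast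
  next
    case True
    have tA: "tight x A" and tB: "tight x B" using A B down by auto
    have BI: "B \<subseteq> I" using tB by (simp add: tight_def)
    have sub: "C1 \<subseteq> B - A" "C2 \<subseteq> B - A" using True by auto
    note c1 = tight_contract[OF assms(1) tA AB BI sub(1)]
    note c2 = tight_contract[OF assms(1) tA AB BI sub(2)]
    have c3: "sum x (B - A) = r B - r A"
    proof -
      have "A \<union> (B - A) = B" using AB by auto
      then show ?thesis
        using tight_contract(2)[OF assms(1) tA AB BI order_refl] tB by simp
    qed
    have fin: "finite C1" "finite C2" using sub BI by (auto intro: finite_sub)
    have sC: "sum x (B - A) = sum x C1 + sum x C2"
      using True fin by (simp add: sum.union_disjoint)
    have "decomposes (B - A) (contract z A) C1 C2 \<longleftrightarrow> r B + r A = r (A \<union> C1) + r (A \<union> C2)"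
      using True AB BI by (intro decomposes_contract_iff) auto
    also have "\<dots> \<longleftrightarrow> tight x (A \<union> C1) \<and> tight x (A \<union> C2)"
      using c1 c2 c3 sC by auto
    also have "\<dots> \<longleftrightarrow> downset I ?P (A \<union> C1) \<and> downset I ?P (A \<union> C2)"
      using down by simp
    also have "\<dots> \<longleftrightarrow> disconnected_union ?P (B - A) C1 C2"
    proof
      assume "downset I ?P (A \<union> C1) \<and> downset I ?P (A \<union> C2)"
      then show "disconnected_union ?P (B - A) C1 C2"
        using True sub unfolding disconnected_union_def downset_def by blast
    next
      assume d: "disconnected_union ?P (B - A) C1 C2"
      have CI: "A \<union> C1 \<subseteq> I" "A \<union> C2 \<subseteq> I" using sub AB BI by auto
      have mem: "a \<in> A \<union> C1 \<union> C2" if "(a, b) \<in> ?P" "b \<in> A \<union> C1 \<union> C2" for a b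
        using that B True AB unfolding downset_def by blast
      have "downset I ?P (A \<union> C1)"
        unfolding downset_def
      proof (intro conjI CI allI impI)
        fix a b assume "(a, b) \<in> ?P" "b \<in> A \<union> C1"
        then show "a \<in> A \<union> C1" using mem[of a b] d A unfolding disconnected_union_def downset_def by blast
      qed
      moreover have "downset I ?P (A \<union> C2)"
        unfolding downset_def
      proof (intro conjI CI allI impI)
        fix a b assume "(a, b) \<in> ?P" "b \<in> A \<union> C2"
        then show "a \<in> A \<union> C2" using mem[of a b] d A unfolding disconnected_union_def downset_def by blast
      qed
      ultimately show "downset I ?P (A \<union> C1) \<and> downset I ?P (A \<union> C2)" by blast
    qed
    finally show ?thesis .
  qed
  have "z A < \<infinity>" if "downset I ?P A" for A
    using that val[of A] by (simp add: downset_def)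
  then show ?thesis
    unfolding Pre_def conforms_def compatible_def
    using key preorder_tight_preorder by auto
qed

text \<open>
  The complement of \<open>A \<inter> B\<close> in \<open>A \<union> B\<close> is the disconnected union of \<open>A - B\<close> and \<open>B - A\<close>.
\<close>

lemma compatible_modular:
  assumes "compatible I z P" "downset I P A" "downset I P B"
  shows "r (A \<union> B) + r (A \<inter> B) = r A + r B"
proof -
  have d: "downset I P (A \<union> B)" "downset I P (A \<inter> B)"
    using assms(2,3) unfolding downset_def by blast+
  have "disconnected_union P (A \<union> B - A \<inter> B) (A - B) (B - A)"
    using assms(2,3) unfolding disconnected_union_def downset_def by blast
  then have "decomposes (A \<union> B - A \<inter> B) (contract z (A \<inter> B)) (A - B) (B - A)"
    using assms(1) d unfolding compatible_def by blast
  moreover have "A \<union> B - A \<inter> B = (A - B) \<union> (B - A)" "(A - B) \<inter> (B - A) = {}" "A \<inter> B \<subseteq> A \<union> B"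
    "A \<union> B \<subseteq> I" using assms unfolding downset_def by auto
  ultimately have "r (A \<union> B) + r (A \<inter> B) = r (A \<inter> B \<union> (A - B)) + r (A \<inter> B \<union> (B - A))"
    using decomposes_contract_iff by blast
  moreover have "A \<inter> B \<union> (A - B) = A" "A \<inter> B \<union> (B - A) = B" by auto
  ultimately show ?thesis by simp
qed

lemma separated_antisym: "separated I x \<longleftrightarrow> antisym (tight_preorder x)"
proof -
  have "(a, b) \<in> tight_preorder x \<and> (b, a) \<in> tight_preorder x \<longleftrightarrow>
      a \<in> I \<and> b \<in> I \<and> (\<forall>A. tight x A \<longrightarrow> (a \<in> A) = (b \<in> A))" for a b
    unfolding tight_preorder_def by blast
  moreover have "A \<subseteq> I" if "tight x A" for A using that by (simp add: tight_def)
  ultimately show ?thesis unfolding separated_def antisym_def by meson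
qed

text \<open>
  The vertices of the base polytope: the points determined by their tight sets.
\<close>

definition vertices :: "('a \<Rightarrow> real) set" where
  "vertices = {x \<in> extensional I. tight x I \<and> dominated I x \<and> antisym (tight_preorder x)}"

lemma exists_vertex:
  assumes D: "D \<subseteq> Pow I" "{} \<in> D" "I \<in> D"
    and closed: "\<And>A B. A \<in> D \<Longrightarrow> B \<in> D \<Longrightarrow> A \<union> B \<in> D \<and> A \<inter> B \<in> D"
    and modular: "\<And>A B. A \<in> D \<Longrightarrow> B \<in> D \<Longrightarrow> r (A \<union> B) + r (A \<inter> B) = r A + r B"
  shows "\<exists>x\<in>vertices. \<forall>A\<in>D. tight x A"
proof -
  obtain x where x: "dominated I x" "\<forall>A\<in>D. A \<subseteq> I \<longrightarrow> tight x A" "separated I x"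
    using exists_tight_on_lattice[OF D(1,2) closed modular D(3)] by blast
  define y where "y = restrict x I"
  have t: "tight y A \<longleftrightarrow> tight x A" if "A \<subseteq> I" for A
    using that by (intro tight_cong) (auto simp: y_def)
  then have t': "tight y = tight x" using tight_def by blast
  have "sum y A = sum x A" if "A \<subseteq> I" for A
    using that by (intro sum.cong) (auto simp: y_def)
  then have "dominated I y" using x(1) by (simp add: dominated_def)
  moreover have "separated I y" using x(3) t' by (simp add: separated_def)
  moreover have "tight y I" "\<forall>A\<in>D. tight y A" using x(2) t' D by auto
  ultimately show ?thesis
    unfolding vertices_def using separated_antisym by (auto simp: y_def)
qed

text \<open>
  In an antisymmetric preorder, both the elements below \<open>a\<close> and the elements strictly below \<open>a\<close> form
  a down-set, and \<open>x a\<close> is the difference of the values of \<open>r\<close> on these two sets.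
\<close>

lemma tight_unique:
  assumes "preorder_on I P" "antisym P"
    and "\<And>A. downset I P A \<Longrightarrow> tight x A \<and> tight y A" and "a \<in> I"
  shows "x a = y a"
proof -
  define B where "B = {b. (b, a) \<in> P}"
  have P: "P \<subseteq> I \<times> I" "trans P" "(a, a) \<in> P" using assms unfolding preorder_on_def refl_on_def by auto
  have 1: "downset I P B" unfolding downset_def B_def using P by (blast dest: transD)
  have 2: "downset I P (B - {a})"
    using 1 assms(2) P unfolding downset_def B_def by (auto dest: transD antisymD)
  have aB: "a \<in> B" "B \<subseteq> I" using P B_def by auto
  have *: "u a = r B - r (B - {a})" if "tight u B" "tight u (B - {a})" for u
    using that aB by (auto simp: tight_def sum_diff1 split: if_splits)
  show ?thesis using * assms(3) 1 2 by metis
qed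

lemma vertices_eqI:
  assumes "x \<in> vertices" "y \<in> vertices" "\<And>A. tight x A \<Longrightarrow> tight y A"
  shows "x = y"
proof (rule extensionalityI[of _ I])
  show "x \<in> extensional I" "y \<in> extensional I" using assms by (auto simp: vertices_def)
  fix a assume "a \<in> I"
  show "x a = y a"
  proof (rule tight_unique[OF preorder_tight_preorder _ _ \<open>a \<in> I\<close>])
    show "antisym (tight_preorder x)" using assms by (simp add: vertices_def)
    show "tight x A \<and> tight y A" if "downset I (tight_preorder x) A" for A
      using that assms downset_tight_preorder[of x A] by (simp add: vertices_def)
  qed
qed

text \<open>
  Every conforming preorder lies above the preorder of a vertex, because the function is modular on
  the lattice of its down-sets. This is why the minimal ones come from vertices.
\<close>

lemma exists_vertex_below:
  assumes "P \<in> Pre I z"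
  shows "\<exists>x\<in>vertices. \<forall>A. downset I P A \<longrightarrow> tight x A"
proof -
  have c: "compatible I z P" "P \<subseteq> I \<times> I" using assms unfolding Pre_def conforms_def preorder_on_def by auto
  have "\<exists>x\<in>vertices. \<forall>A\<in>{A. downset I P A}. tight x A"
  proof (rule exists_vertex)
    show "{A. downset I P A} \<subseteq> Pow I" "{} \<in> {A. downset I P A}" "I \<in> {A. downset I P A}"
      using c by (auto simp: downset_def)
    show "A \<union> B \<in> {A. downset I P A} \<and> A \<inter> B \<in> {A. downset I P A}"
      if "A \<in> {A. downset I P A}" "B \<in> {A. downset I P A}" for A B
      using that by (auto simp: downset_def)
  qed (auto intro: compatible_modular[OF c(1)])
  then show ?thesis by blast
qed

text \<open>
  That the preorder of a vertex \<open>x\<close> is minimal: a conforming preorder below it has at least the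
  tight sets of \<open>x\<close> as down-sets and itself lies above the preorder of a vertex \<open>y\<close>, which is then
  tight wherever \<open>x\<close> is, so that \<open>y = x\<close>.
\<close>

lemma bij_betw_vertices_minPre: "bij_betw tight_preorder vertices (minPre I z)"
  unfolding bij_betw_def
proof (intro conjI equalityI subsetI)
  have pre: "tight_preorder x \<in> Pre I z" if "x \<in> vertices" for x
    using tight_preorder_in_Pre that by (simp add: vertices_def)
  have down: "downset I (tight_preorder x) A \<longleftrightarrow> tight x A" if "x \<in> vertices" for x A
    using downset_tight_preorder that by (simp add: vertices_def)
  show "inj_on tight_preorder vertices"
    by (rule inj_onI) (metis down vertices_eqI)
  fix P
  show "P \<in> minPre I z" if P: "P \<in> tight_preorder ` vertices"
  proof -
    obtain x where x: "x \<in> vertices" "P = tight_preorder x" using P by auto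
    have "Q = P" if Q: "Q \<in> Pre I z" "Q \<subseteq> P" for Q
    proof -
      obtain y where y: "y \<in> vertices" "\<And>A. downset I Q A \<Longrightarrow> tight y A"
        using exists_vertex_below[OF Q(1)] by blast
      have "tight y A" if "tight x A" for A
        using that y(2) down x downset_mono[OF Q(2)] by blast
      then have "x = y" using vertices_eqI x(1) y(1) by blast
      have "P \<subseteq> Q"
        using Q(1) x y \<open>x = y\<close> down preorder_tight_preorder
        by (intro subset_of_downsets) (auto simp: Pre_def)
      then show ?thesis using Q(2) by blast
    qed
    then show ?thesis using x pre by (auto simp: minPre_def)
  qed
  show "P \<in> tight_preorder ` vertices" if P: "P \<in> minPre I z"
  proof -
    have PP: "P \<in> Pre I z" using P by (simp add: minPre_def)
    then obtain x where x: "x \<in> vertices" "\<And>A. downset I P A \<Longrightarrow> tight x A"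
      using exists_vertex_below by blast
    have "tight_preorder x \<subseteq> P"
      using PP x down preorder_tight_preorder
      by (intro subset_of_downsets) (auto simp: Pre_def)
    then have "tight_preorder x = P" using P pre[OF x(1)] by (auto simp: minPre_def)
    then show ?thesis using x(1) by blast
  qed
qed

lemma finite_vertices: "finite vertices"
proof -
  have "minPre I z \<subseteq> Pow (I \<times> I)" by (auto simp: minPre_def Pre_def preorder_on_def)
  then have "finite (minPre I z)" using finite_ground finite_subset by blast
  then show ?thesis using bij_betw_finite[OF bij_betw_vertices_minPre] by simp
qed

end

section \<open>The basic invariant through additive minors\<close>

lemma ordered_decompositions_0:
  "ordered_decompositions I 0 = (if I = {} then {[]} else {})"
  by (auto simp: ordered_decompositions_def)

lemma Cons_in_ordered_decompositions:
  "S # Ss \<in> ordered_decompositions I (Suc n) \<longleftrightarrow>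
     S \<subseteq> I \<and> Ss \<in> ordered_decompositions (I - S) n"
proof -
  have "(\<forall>i<Suc n. \<forall>j<Suc n. i \<noteq> j \<longrightarrow> (S # Ss) ! i \<inter> (S # Ss) ! j = {}) \<longleftrightarrow>
      (\<forall>j<n. S \<inter> Ss ! j = {}) \<and> (\<forall>i<n. \<forall>j<n. i \<noteq> j \<longrightarrow> Ss ! i \<inter> Ss ! j = {})"
    unfolding All_less_Suc2 by (auto simp: Int_commute; blast)
  moreover have "(\<forall>j<n. S \<inter> Ss ! j = {}) \<longleftrightarrow> S \<inter> \<Union> (set Ss) = {}" if "length Ss = n"
    using that by (fastforce simp: in_set_conv_nth)
  ultimately show ?thesis
    unfolding ordered_decompositions_def by auto
qed

lemma ordered_decompositions_Suc:
  "ordered_decompositions I (Suc n) = (\<Union>S\<in>Pow I. (#) S ` ordered_decompositions (I - S) n)"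
proof -
  have "Ss \<in> ordered_decompositions I (Suc n) \<longleftrightarrow>
      Ss \<in> (\<Union>S\<in>Pow I. (#) S ` ordered_decompositions (I - S) n)" for Ss
  proof (cases Ss)
    case Nil
    then show ?thesis by (auto simp: ordered_decompositions_def)
  next
    case (Cons S Ts)
    then show ?thesis using Cons_in_ordered_decompositions[of S Ts] by auto
  qed
  then show ?thesis by blast
qed

lemma finite_ordered_decompositions: "finite I \<Longrightarrow> finite (ordered_decompositions I n)"
  by (induction n arbitrary: I) (simp_all add: ordered_decompositions_0 ordered_decompositions_Suc)

lemma sum_ordered_decompositions_Suc:
  assumes "finite I"
  shows "(\<Sum>Ss\<in>ordered_decompositions I (Suc n). F Ss) =
    (\<Sum>S\<in>Pow I. \<Sum>Ss\<in>ordered_decompositions (I - S) n. F (S # Ss))"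
proof -
  have "(\<Sum>Ss\<in>ordered_decompositions I (Suc n). F Ss) =
      (\<Sum>S\<in>Pow I. \<Sum>Ss\<in>(#) S ` ordered_decompositions (I - S) n. F Ss)"
    unfolding ordered_decompositions_Suc using assms
    by (intro sum.UNION_disjoint) (auto intro: finite_ordered_decompositions)
  also have "\<dots> = (\<Sum>S\<in>Pow I. \<Sum>Ss\<in>ordered_decompositions (I - S) n. F (S # Ss))"
    by (simp add: sum.reindex)
  finally show ?thesis .
qed

lemma Union_ordered_decomposition: "Ss \<in> ordered_decompositions I n \<Longrightarrow> \<Union> (set Ss) = I"
  by (simp add: ordered_decompositions_def)

text \<open>
  The function \<open>z\<close> is modular and finite on the subsets of \<open>S\<close>, with \<open>x\<close> as a witness. Keeping the
  witness visible is what allows modular minors to be glued to a single point of the polytope.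
\<close>

definition additive_on :: "'a set \<Rightarrow> ('a set \<Rightarrow> ereal) \<Rightarrow> ('a \<Rightarrow> real) \<Rightarrow> bool" where
  "additive_on S z x \<longleftrightarrow> (\<forall>E\<subseteq>S. z E = ereal (sum x E))"

lemma additive_on_cong:
  assumes "\<And>a. a \<in> S \<Longrightarrow> x a = y a"
  shows "additive_on S z x \<longleftrightarrow> additive_on S z y"
proof -
  have "sum x E = sum y E" if "E \<subseteq> S" for E
    using that assms by (intro sum.cong) auto
  then show ?thesis by (auto simp: additive_on_def)
qed

text \<open>
  If the base polytope is a point, then this point is tight on every set \<open>E\<close>, because some point of
  the polytope is tight on a given \<open>E\<close>. If \<open>z\<close> is additive with values \<open>x\<close>, then \<open>x\<close> bounds each
  coordinate of any other point from above, and the coordinate sums agree.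
\<close>

lemma (in finite_submodular) basic_character_eq:
  "basic_character I z = of_bool (\<exists>x. additive_on I z x)"
proof -
  have "is_singleton (base_polytope I z) \<longleftrightarrow> (\<exists>x. additive_on I z x)"
  proof
    assume "is_singleton (base_polytope I z)"
    then obtain x where x: "base_polytope I z = {x}" by (auto simp: is_singleton_def)
    have "tight x E" if "E \<subseteq> I" for E
    proof -
      \<comment> \<open>On a chain of sets every function is modular.\<close>
      have "\<exists>y\<in>vertices. \<forall>A\<in>{{}, E, I}. tight y A"
        using that by (intro exists_vertex) (auto simp: Un_absorb1 Un_absorb2 Int_absorb1 Int_absorb2 empty)
      then obtain y where "y \<in> vertices" "tight y E" by auto
      moreover from this have "y \<in> base_polytope I z"
        by (auto simp: vertices_def base_polytope_iff)
      ultimately show ?thesis using x by auto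
    qed
    then have "additive_on I z x" by (auto simp: additive_on_def tight_def val)
    then show "\<exists>x. additive_on I z x" by blast
  next
    assume "\<exists>x. additive_on I z x"
    then obtain x' where x': "additive_on I z x'" ..
    define x where "x = restrict x' I"
    have x: "sum x E = r E" if "E \<subseteq> I" for E
    proof -
      have "additive_on I z x" using x' additive_on_cong[of I x x' z] by (simp add: x_def)
      then show ?thesis using that val by (auto simp: additive_on_def)
    qed
    have ext: "x \<in> extensional I" by (simp add: x_def)
    have "base_polytope I z = {x}"
    proof (intro equalityI subsetI)
      fix y assume "y \<in> {x}"
      then show "y \<in> base_polytope I z"
        using x ext by (auto simp: base_polytope_iff tight_def dominated_def)
    next
      fix y assume y: "y \<in> base_polytope I z"
      have le: "y a \<le> x a" if "a \<in> I" for a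
      proof -
        have "sum y {a} \<le> r {a}" using y that unfolding base_polytope_iff dominated_def by blast
        then show ?thesis using x[of "{a}"] that by simp
      qed
      have "sum y I = sum x I" using y x[of I] by (simp add: base_polytope_iff tight_def)
      then have "y a = x a" if "a \<in> I" for a
        using sum_mono_inv[of y I x a] le that finite_ground by blast
      then have "y = x"
        using y by (intro extensionalityI[of y I x]) (auto simp: base_polytope_iff x_def)
      then show "y \<in> {x}" by simp
    qed
    then show "is_singleton (base_polytope I z)" by simp
  qed
  then show ?thesis by (simp add: basic_character_def)
qed

text \<open>
  Every minor of \<open>z\<close> between consecutive initial unions of the decomposition is given by summing \<open>x\<close>.
\<close>

fun additive_along :: "'a set list \<Rightarrow> ('a set \<Rightarrow> ereal) \<Rightarrow> ('a \<Rightarrow> real) \<Rightarrow> bool" where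
  "additive_along [] z x \<longleftrightarrow> True"
| "additive_along (S # Ss) z x \<longleftrightarrow> additive_on S z x \<and> additive_along Ss (contract z S) x"

lemma additive_along_cong:
  assumes "\<And>a. a \<in> \<Union> (set Ss) \<Longrightarrow> x a = y a"
  shows "additive_along Ss z x \<longleftrightarrow> additive_along Ss z y"
  using assms
proof (induction Ss arbitrary: z)
  case (Cons S Ss)
  then show ?case using additive_on_cong[of S x y z] by auto
qed simp

text \<open>
  The blocks are disjoint, so witnesses for the individual minors combine into one function.
\<close>

lemma basic_on_coproduct_eq:
  assumes "finite_submodular I z r" "Ss \<in> ordered_decompositions I n"
  shows "basic_on_coproduct Ss z = of_bool (\<exists>x. additive_along Ss z x)"
  using assms
proof (induction n arbitrary: I z r Ss)
  case 0
  then show ?case by (auto simp: ordered_decompositions_0 split: if_splits)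
next
  case (Suc n)
  interpret finite_submodular I z r by fact
  obtain S Ts where Ss: "Ss = S # Ts" and S: "S \<subseteq> I" and Ts: "Ts \<in> ordered_decompositions (I - S) n"
    using Suc.prems(2) by (auto simp: ordered_decompositions_Suc)
  have "basic_character S z = of_bool (\<exists>x. additive_on S z x)"
    using finite_submodular.basic_character_eq[OF restriction[OF S]] .
  moreover have "basic_on_coproduct Ts (contract z S) = of_bool (\<exists>x. additive_along Ts (contract z S) x)"
    using Suc.IH[OF contraction[OF S] Ts] .
  moreover have "(\<exists>x. additive_along Ss z x) \<longleftrightarrow>
      (\<exists>x. additive_on S z x) \<and> (\<exists>x. additive_along Ts (contract z S) x)"
  proof
    assume "(\<exists>x. additive_on S z x) \<and> (\<exists>x. additive_along Ts (contract z S) x)"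
    then obtain x y where xy: "additive_on S z x" "additive_along Ts (contract z S) y" by auto
    define u where "u = (\<lambda>a. if a \<in> S then x a else y a)"
    have "additive_on S z u" using xy(1) additive_on_cong[of S u x z] by (simp add: u_def)
    moreover have "additive_along Ts (contract z S) u"
      using xy(2) additive_along_cong[of Ts u y] Union_ordered_decomposition[OF Ts]
      by (simp add: u_def)
    ultimately show "\<exists>x. additive_along Ss z x" using Ss by auto
  qed (auto simp: Ss)
  ultimately show ?case using val[OF S] by (simp add: Ss)
qed

text \<open>
  The conclusion says that \<open>x\<close>, restricted to \<open>I\<close>, is a vertex of the base polytope. Submodularity
  bounds \<open>x(A)\<close> after splitting \<open>A\<close> at the first block; singletons in the first block, and their
  analogues in the later ones, separate points.
\<close>

lemma additive_along_vertex:
  assumes "finite_submodular I z r" "Ss \<in> ordered_decompositions I n" "additive_along Ss z x"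
  shows "(\<forall>A\<subseteq>I. sum x A \<le> r A) \<and> sum x I = r I \<and>
    (\<forall>a\<in>I. \<forall>b\<in>I. a \<noteq> b \<longrightarrow> (\<exists>A\<subseteq>I. sum x A = r A \<and> (a \<in> A) \<noteq> (b \<in> A)))"
  using assms
proof (induction n arbitrary: I z r Ss)
  case 0
  then have "I = {}" by (auto simp: ordered_decompositions_0 split: if_splits)
  then show ?case using finite_submodular.empty[OF 0(1)] by simp
next
  case (Suc n)
  interpret finite_submodular I z r by fact
  obtain S Ts where Ss: "Ss = S # Ts" and S: "S \<subseteq> I" and Ts: "Ts \<in> ordered_decompositions (I - S) n"
    using Suc.prems(2) by (auto simp: ordered_decompositions_Suc)
  have xS: "sum x E = r E" if "E \<subseteq> S" for E
    using Suc.prems(3) that val[of E] S by (auto simp: Ss additive_on_def)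
  have IH: "(\<forall>A\<subseteq>I - S. sum x A \<le> r (S \<union> A) - r S) \<and> sum x (I - S) = r (S \<union> (I - S)) - r S \<and>
    (\<forall>a\<in>I - S. \<forall>b\<in>I - S. a \<noteq> b \<longrightarrow>
      (\<exists>A\<subseteq>I - S. sum x A = r (S \<union> A) - r S \<and> (a \<in> A) \<noteq> (b \<in> A)))"
    using Suc.IH[OF contraction[OF S] Ts] Suc.prems(3) by (simp add: Ss)
  have split: "sum x A = sum x (A \<inter> S) + sum x (A - S)" if "A \<subseteq> I" for A
    using sum.Int_Diff[of A x S] that by simp
  have dom: "sum x A \<le> r A" if A: "A \<subseteq> I" for A
  proof -
    have "sum x A \<le> r (A \<inter> S) + (r (S \<union> (A - S)) - r S)"
    proof -
      have "sum x (A - S) \<le> r (S \<union> (A - S)) - r S" using conjunct1[OF IH, rule_format, of "A - S"] A by blast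
      then show ?thesis using split[OF A] xS[of "A \<inter> S"] by simp
    qed
    also have "\<dots> \<le> r A"
      using submodular[OF A S] by (simp add: Un_commute)
    finally show ?thesis .
  qed
  moreover have "sum x I = r I"
  proof -
    have "S \<union> (I - S) = I" "I \<inter> S = S" using S by auto
    then show ?thesis using split[of I] IH xS[of S] by simp
  qed
  moreover have "\<exists>A\<subseteq>I. sum x A = r A \<and> (a \<in> A) \<noteq> (b \<in> A)" if ab: "a \<in> I" "b \<in> I" "a \<noteq> b" for a b
  proof -
    consider "a \<in> S" | "b \<in> S" | "a \<in> I - S" "b \<in> I - S" using ab by blast
    then show ?thesis
    proof cases
      case 1
      then show ?thesis using xS[of "{a}"] S ab by (intro exI[of _ "{a}"]) auto
    next
      case 2
      then show ?thesis using xS[of "{b}"] S ab by (intro exI[of _ "{b}"]) auto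
    next
      case 3
      then obtain A where A: "A \<subseteq> I - S" "sum x A = r (S \<union> A) - r S" "(a \<in> A) \<noteq> (b \<in> A)"
        using IH ab by meson
      have "sum x (S \<union> A) = sum x S + sum x A"
        using A S by (intro sum.union_disjoint) (auto intro: finite_sub)
      then have "sum x (S \<union> A) = r (S \<union> A)" using A xS[of S] by simp
      then show ?thesis using A 3 S by (intro exI[of _ "S \<union> A"]) auto
    qed
  qed
  ultimately show ?case by blast
qed

lemma additive_along_unique:
  assumes "Ss \<in> ordered_decompositions I n" "additive_along Ss z x" "additive_along Ss z y" "a \<in> I"
  shows "x a = y a"
  using assms
proof (induction n arbitrary: I z Ss)
  case 0
  then show ?case by (auto simp: ordered_decompositions_0 split: if_splits)
next
  case (Suc n)
  obtain S Ts where Ss: "Ss = S # Ts" and S: "S \<subseteq> I" and Ts: "Ts \<in> ordered_decompositions (I - S) n"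
    using Suc.prems(1) by (auto simp: ordered_decompositions_Suc)
  show ?case
  proof (cases "a \<in> S")
    case True
    then have "z {a} = ereal (sum x {a})" "z {a} = ereal (sum y {a})"
      using Suc.prems(2,3) unfolding Ss additive_along.simps additive_on_def by blast+
    then show ?thesis by simp
  next
    case False
    then show ?thesis using Suc.IH[OF Ts, of "contract z S"] Suc.prems by (simp add: Ss)
  qed
qed

text \<open>
  The ordered decompositions that contribute to \<open>\<theta>\<close> at \<open>z\<^sup>P\<close>: initial unions are down-sets, and the
  counit \<open>\<epsilon>\<^sub>\<delta>\<close> of the minor on each block is \<open>1\<close>.
\<close>

fun graded_by :: "'a set list \<Rightarrow> 'a set \<Rightarrow> 'a rel \<Rightarrow> bool" where
  "graded_by [] I P \<longleftrightarrow> True"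
| "graded_by (S # Ss) I P \<longleftrightarrow>
     downset I P S \<and> equiv S (Restr P S) \<and> graded_by Ss (I - S) (Restr P (I - S))"

lemma preorder_on_Restr: "preorder_on I P \<Longrightarrow> S \<subseteq> I \<Longrightarrow> preorder_on S (Restr P S)"
  unfolding preorder_on_def refl_on_def trans_def by blast

lemma downset_contraction:
  assumes "P \<subseteq> I \<times> I" "downset I P S" "A \<subseteq> I - S"
  shows "downset (I - S) (Restr P (I - S)) A \<longleftrightarrow> downset I P (S \<union> A)"
  using assms unfolding downset_def by blast

lemma downset_restriction:
  assumes "downset I P S" "A \<subseteq> S"
  shows "downset S (Restr P S) A \<longleftrightarrow> downset I P A"
  using assms unfolding downset_def by blast

text \<open>
  The hypothesis says that the down-sets of \<open>P\<close> are the tight sets of \<open>x\<close>. An equivalence relation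
  contained in an antisymmetric one is equality, so a block that is a down-set has all its subsets
  as down-sets; these are then tight, and the restriction of \<open>z\<close> to the block is additive.
\<close>

lemma graded_by_iff_additive_along:
  assumes "finite_submodular I z r" "Ss \<in> ordered_decompositions I n"
    and "preorder_on I P" "antisym P" "\<And>A. A \<subseteq> I \<Longrightarrow> downset I P A \<longleftrightarrow> sum x A = r A"
  shows "graded_by Ss I P \<longleftrightarrow> additive_along Ss z x"
  using assms
proof (induction n arbitrary: I z r Ss P)
  case 0
  then show ?case by (auto simp: ordered_decompositions_0 split: if_splits)
next
  case (Suc n)
  interpret finite_submodular I z r by fact
  obtain S Ts where Ss: "Ss = S # Ts" and S: "S \<subseteq> I" and Ts: "Ts \<in> ordered_decompositions (I - S) n"
    using Suc.prems(2) by (auto simp: ordered_decompositions_Suc)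
  note down = Suc.prems(5)
  have PI: "P \<subseteq> I \<times> I" "\<And>a. a \<in> I \<Longrightarrow> (a, a) \<in> P"
    using Suc.prems(3) by (auto simp: preorder_on_def refl_on_def)
  have 1: "downset I P S \<and> equiv S (Restr P S) \<longleftrightarrow> additive_on S z x"
  proof -
    have "additive_on S z x \<longleftrightarrow> (\<forall>E\<subseteq>S. downset I P E)"
    proof -
      have "z E = ereal (sum x E) \<longleftrightarrow> downset I P E" if "E \<subseteq> S" for E
      proof -
        have "E \<subseteq> I" using that S by blast
        then show ?thesis using down[of E] val[of E] by auto
      qed
      then show ?thesis unfolding additive_on_def by blast
    qed
    also have "\<dots> \<longleftrightarrow> downset I P S \<and> equiv S (Restr P S)"
    proof
      assume d: "\<forall>E\<subseteq>S. downset I P E"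
      have "a = b" if "(a, b) \<in> P" "b \<in> S" for a b
        using d[rule_format, of "{b}"] that unfolding downset_def by blast
      then have "Restr P S = Id_on S" using PI(2) S by auto
      then show "downset I P S \<and> equiv S (Restr P S)"
        using d by (auto simp: equiv_def refl_on_def sym_def trans_def)
    next
      assume d: "downset I P S \<and> equiv S (Restr P S)"
      have "a = b" if ab: "(a, b) \<in> P" "b \<in> S" for a b
      proof -
        have "a \<in> S" using d ab unfolding downset_def by blast
        then have "(b, a) \<in> P" using d ab unfolding equiv_def sym_def by blast
        then show ?thesis using ab(1) Suc.prems(4) unfolding antisym_def by blast
      qed
      then show "\<forall>E\<subseteq>S. downset I P E" using S unfolding downset_def by blast
    qed
    finally show ?thesis by blast
  qed
  have 2: "graded_by Ts (I - S) (Restr P (I - S)) \<longleftrightarrow> additive_along Ts (contract z S) x"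
    if dS: "downset I P S"
  proof (rule Suc.IH[OF contraction[OF S] Ts])
    show "preorder_on (I - S) (Restr P (I - S))"
      using Suc.prems(3) by (rule preorder_on_Restr) auto
    show "antisym (Restr P (I - S))" using Suc.prems(4) unfolding antisym_def by blast
    fix A assume A: "A \<subseteq> I - S"
    have SA: "S \<union> A \<subseteq> I" using A S by auto
    have "sum x (S \<union> A) = sum x S + sum x A"
      using A S by (intro sum.union_disjoint) (auto intro: finite_sub)
    moreover have "sum x S = r S" using dS down S by blast
    ultimately show "downset (I - S) (Restr P (I - S)) A \<longleftrightarrow> sum x A = r (S \<union> A) - r S"
      using downset_contraction[OF PI(1) dS A] down[OF SA] by auto
  qed
  show ?case using 1 2 by (auto simp: Ss)
qed

text \<open>
  For a fixed decomposition the inner count is \<open>1\<close> or \<open>0\<close>: a function additive along it is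
  automatically a vertex, and is unique.
\<close>

lemma (in finite_submodular) sum_vertices_graded_by:
  "(\<Sum>x\<in>vertices. \<Sum>Ss\<in>ordered_decompositions I n. of_bool (graded_by Ss I (tight_preorder x))) =
   (\<Sum>Ss\<in>ordered_decompositions I n. basic_on_coproduct Ss z)"
proof -
  note fs = finite_submodular_axioms
  have "(\<Sum>x\<in>vertices. of_bool (graded_by Ss I (tight_preorder x))) = basic_on_coproduct Ss z"
    if Ss: "Ss \<in> ordered_decompositions I n" for Ss
  proof -
    have g: "graded_by Ss I (tight_preorder x) \<longleftrightarrow> additive_along Ss z x" if "x \<in> vertices" for x
    proof (rule graded_by_iff_additive_along[OF fs Ss preorder_tight_preorder])
      show "antisym (tight_preorder x)" using that by (simp add: vertices_def)
      show "downset I (tight_preorder x) A \<longleftrightarrow> sum x A = r A" if "A \<subseteq> I" for A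
        using downset_tight_preorder[of x A] \<open>x \<in> vertices\<close> that by (simp add: vertices_def tight_def)
    qed
    show ?thesis
    proof (cases "\<exists>x. additive_along Ss z x")
      case False
      then show ?thesis using g basic_on_coproduct_eq[OF fs Ss] by simp
    next
      case True
      then obtain x' where x': "additive_along Ss z x'" ..
      define x where "x = restrict x' I"
      have x: "additive_along Ss z x"
        using x' additive_along_cong[of Ss x x' z] Union_ordered_decomposition[OF Ss]
        by (simp add: x_def)
      have xv: "x \<in> vertices"
        using additive_along_vertex[OF fs Ss x] separated_antisym[of x]
        by (auto simp: vertices_def x_def dominated_def tight_def separated_def)
      have uniq: "y = x" if "y \<in> vertices" "additive_along Ss z y" for y
        using additive_along_unique[OF Ss that(2) x] that(1) xv
        by (intro extensionalityI[of y I x]) (auto simp: vertices_def)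
      have "graded_by Ss I (tight_preorder y) \<longleftrightarrow> y = x" if "y \<in> vertices" for y
        using g[OF that] x uniq[OF that] by blast
      then have "(\<Sum>y\<in>vertices. of_bool (graded_by Ss I (tight_preorder y))) =
          (\<Sum>y\<in>vertices. if y = x then 1 else (0::real))"
        by (intro sum.cong) auto
      also have "\<dots> = 1" using xv finite_vertices by simp
      finally show ?thesis using True basic_on_coproduct_eq[OF fs Ss] by simp
    qed
  qed
  then show ?thesis by (subst sum.swap) (simp cong: sum.cong)
qed

lemma additive_on_transport:
  assumes "bij_betw \<sigma> J I" "\<And>A. A \<subseteq> J \<Longrightarrow> w A = z (\<sigma> ` A)"
  shows "(\<exists>x. additive_on J w x) \<longleftrightarrow> (\<exists>x. additive_on I z x)"
proof
  have inj: "inj_on \<sigma> E" if "E \<subseteq> J" for E using assms(1) that by (auto simp: bij_betw_def inj_on_subset)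
  have im: "\<sigma> ` J = I" using assms(1) by (simp add: bij_betw_def)
  {
    assume "\<exists>x. additive_on I z x"
    then obtain x where "additive_on I z x" ..
    then have "additive_on J w (x \<circ> \<sigma>)"
      using assms(2) inj im by (auto simp: additive_on_def sum.reindex image_mono)
    then show "\<exists>x. additive_on J w x" by blast
  next
    assume "\<exists>x. additive_on J w x"
    then obtain x where x: "additive_on J w x" ..
    define y where "y = x \<circ> inv_into J \<sigma>"
    have "z E = ereal (sum y E)" if E: "E \<subseteq> I" for E
    proof -
      obtain A where A: "A \<subseteq> J" "E = \<sigma> ` A" using E im by (metis subset_imageE)
      have "sum y E = sum (y \<circ> \<sigma>) A" using A inj by (simp add: sum.reindex)
      also have "\<dots> = sum x A"
        using A inj[of J] by (intro sum.cong) (auto simp: y_def inv_into_f_f subsetD)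
      finally show ?thesis using x A assms(2)[OF A(1)] by (simp add: additive_on_def)
    qed
    then show "\<exists>x. additive_on I z x" by (auto simp: additive_on_def)
  }
qed

lemma sum_basic_on_coproduct_Suc:
  assumes "finite_submodular I z r"
  shows "(\<Sum>Ss\<in>ordered_decompositions I (Suc n). basic_on_coproduct Ss z) =
    (\<Sum>S\<in>Pow I. of_bool (\<exists>x. additive_on S z x) *
      (\<Sum>Ss\<in>ordered_decompositions (I - S) n. basic_on_coproduct Ss (contract z S)))"
proof -
  interpret finite_submodular I z r by fact
  have "basic_on_coproduct (S # Ss) z = of_bool (\<exists>x. additive_on S z x) * basic_on_coproduct Ss (contract z S)"
    if "S \<in> Pow I" for S Ss
    using that val[of S] finite_submodular.basic_character_eq[OF restriction[of S]] by simp
  then show ?thesis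
    unfolding sum_ordered_decompositions_Suc[OF finite_ground] sum_distrib_left
    by (intro sum.cong refl) blast
qed

text \<open>
  The basic invariant depends only on the isomorphism class, so it may be computed on the
  representative on which \<open>\<phi>\<close> is evaluated.
\<close>

lemma sum_basic_on_coproduct_transport:
  assumes "finite_submodular I z r" "finite_submodular J w s"
    and "bij_betw \<sigma> J I" "\<And>A. A \<subseteq> J \<Longrightarrow> w A = z (\<sigma> ` A)"
  shows "(\<Sum>Ss\<in>ordered_decompositions J n. basic_on_coproduct Ss w) =
    (\<Sum>Ss\<in>ordered_decompositions I n. basic_on_coproduct Ss z)"
  using assms
proof (induction n arbitrary: I z r J w s)
  case 0
  then have "J = {} \<longleftrightarrow> I = {}" by (auto simp: bij_betw_def)
  then show ?case by (simp add: ordered_decompositions_0)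
next
  case (Suc n)
  have inj: "inj_on \<sigma> J" and im: "\<sigma> ` J = I" using Suc.prems by (auto simp: bij_betw_def)
  have *: "of_bool (\<exists>x. additive_on S w x) *
      (\<Sum>Ss\<in>ordered_decompositions (J - S) n. basic_on_coproduct Ss (contract w S)) =
      of_bool (\<exists>x. additive_on (\<sigma> ` S) z x) *
      (\<Sum>Ss\<in>ordered_decompositions (I - \<sigma> ` S) n. basic_on_coproduct Ss (contract z (\<sigma> ` S)))"
    if S: "S \<subseteq> J" for S
  proof -
    have b: "bij_betw \<sigma> S (\<sigma> ` S)" "bij_betw \<sigma> (J - S) (I - \<sigma> ` S)"
      using inj im S by (auto simp: bij_betw_def inj_on_image_set_diff intro: inj_on_subset)
    have "(\<exists>x. additive_on S w x) \<longleftrightarrow> (\<exists>x. additive_on (\<sigma> ` S) z x)"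
      using b(1) Suc.prems(4) S by (intro additive_on_transport) auto
    moreover have "(\<Sum>Ss\<in>ordered_decompositions (J - S) n. basic_on_coproduct Ss (contract w S)) =
      (\<Sum>Ss\<in>ordered_decompositions (I - \<sigma> ` S) n. basic_on_coproduct Ss (contract z (\<sigma> ` S)))"
    proof (rule Suc.IH)
      show "finite_submodular (I - \<sigma> ` S) (contract z (\<sigma> ` S)) (\<lambda>A. r (\<sigma> ` S \<union> A) - r (\<sigma> ` S))"
        using S im by (intro finite_submodular.contraction[OF Suc.prems(1)]) auto
      show "finite_submodular (J - S) (contract w S) (\<lambda>A. s (S \<union> A) - s S)"
        using S by (intro finite_submodular.contraction[OF Suc.prems(2)])
      show "bij_betw \<sigma> (J - S) (I - \<sigma> ` S)" by fact
      show "contract w S A = contract z (\<sigma> ` S) (\<sigma> ` A)" if "A \<subseteq> J - S" for A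
      proof -
        have "S \<union> A \<subseteq> J" using that S by auto
        then show ?thesis using Suc.prems(4) S by (simp add: contract_def image_Un)
      qed
    qed
    ultimately show ?thesis by simp
  qed
  have "inj_on ((`) \<sigma>) (Pow J)" using inj by (rule inj_on_image_Pow)
  moreover have "(`) \<sigma> ` Pow J = Pow I" using im by (simp add: image_Pow_surj)
  ultimately have b: "bij_betw ((`) \<sigma>) (Pow J) (Pow I)" by (simp add: bij_betw_def)
  show ?case
    unfolding sum_basic_on_coproduct_Suc[OF Suc.prems(1)] sum_basic_on_coproduct_Suc[OF Suc.prems(2)]
    by (subst sum.reindex_bij_betw[OF b, symmetric]) (rule sum.cong[OF refl], rule *, simp)
qed

section \<open>Morphisms to the double bialgebra of polynomials\<close>

lemma lookup_scaleR [simp]: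
  "Poly_Mapping.lookup (c *\<^sub>R v) b = c *\<^sub>R Poly_Mapping.lookup v b"
proof -
  have "finite {i. c *\<^sub>R Poly_Mapping.lookup v i \<noteq> 0}"
    by (rule finite_subset[OF _ finite_keys[of v]]) (auto simp: in_keys_iff)
  then show ?thesis by (simp add: scaleR_poly_mapping_def)
qed

lemma lin_ext_superset:
  assumes "finite K" "Poly_Mapping.keys v \<subseteq> K"
  shows "lin_ext f v = (\<Sum>b\<in>K. Poly_Mapping.lookup v b *\<^sub>R f b)"
  unfolding lin_ext_def using assms by (intro sum.mono_neutral_left) (auto simp: in_keys_iff)

lemma linear_lin_ext: "linear (lin_ext f)"
proof (rule linearI)
  fix v w :: "'a \<Rightarrow>\<^sub>0 real"
  let ?K = "Poly_Mapping.keys v \<union> Poly_Mapping.keys w"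
  have "Poly_Mapping.keys (v + w) \<subseteq> ?K" by (rule keys_add)
  then show "lin_ext f (v + w) = lin_ext f v + lin_ext f w"
    by (simp add: lin_ext_superset[of ?K] lookup_add scaleR_add_left sum.distrib)
next
  fix c :: real and v :: "'a \<Rightarrow>\<^sub>0 real"
  have "Poly_Mapping.keys (c *\<^sub>R v) \<subseteq> Poly_Mapping.keys v" by (auto simp: in_keys_iff)
  then show "lin_ext f (c *\<^sub>R v) = c *\<^sub>R lin_ext f v"
    by (simp add: lin_ext_superset[of "Poly_Mapping.keys v"] scaleR_sum_right)
qed

lemma lin_ext_basis [simp]: "lin_ext f (basis b) = f b"
  by (simp add: lin_ext_def)

lemma sum_lookup_basis: "(\<Sum>b\<in>Poly_Mapping.keys v. Poly_Mapping.lookup v b *\<^sub>R basis b) = v"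
proof (rule poly_mapping_eqI)
  fix k
  have "Poly_Mapping.lookup (\<Sum>b\<in>Poly_Mapping.keys v. Poly_Mapping.lookup v b *\<^sub>R basis b) k =
      (\<Sum>b\<in>Poly_Mapping.keys v. if b = k then Poly_Mapping.lookup v b else 0)"
    unfolding lookup_sum by (intro sum.cong) (auto simp: lookup_single)
  also have "\<dots> = Poly_Mapping.lookup v k" by (simp add: in_keys_iff)
  finally show "Poly_Mapping.lookup (\<Sum>b\<in>Poly_Mapping.keys v. Poly_Mapping.lookup v b *\<^sub>R basis b) k =
      Poly_Mapping.lookup v k" .
qed

lemma linear_eq_on_basis:
  fixes f g :: "('b \<Rightarrow>\<^sub>0 real) \<Rightarrow> 'v::real_vector"
  assumes "linear f" "linear g" "\<And>b. f (basis b) = g (basis b)"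
  shows "f v = g v"
proof -
  have "f (\<Sum>b\<in>Poly_Mapping.keys v. Poly_Mapping.lookup v b *\<^sub>R basis b) =
      g (\<Sum>b\<in>Poly_Mapping.keys v. Poly_Mapping.lookup v b *\<^sub>R basis b)"
    using assms by (simp add: linear_sum linear_scale)
  then show ?thesis by (simp only: sum_lookup_basis)
qed

lemma tensor_basis [simp]: "tensor (basis b) (basis c) = basis (b, c)"
  by (simp add: tensor_def)

text \<open>
  The functional \<open>\<alpha> \<otimes> \<beta>\<close> on the tensor product.
\<close>

definition pairing :: "(('b \<Rightarrow>\<^sub>0 real) \<Rightarrow> real) \<Rightarrow> (('c \<Rightarrow>\<^sub>0 real) \<Rightarrow> real) \<Rightarrow> ('b \<times> 'c \<Rightarrow>\<^sub>0 real) \<Rightarrow> real" where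
  "pairing \<alpha> \<beta> = lin_ext (\<lambda>(b, c). \<alpha> (basis b) * \<beta> (basis c))"

lemma linear_pairing: "linear (pairing \<alpha> \<beta>)"
  unfolding pairing_def by (rule linear_lin_ext)

lemma pairing_basis [simp]: "pairing \<alpha> \<beta> (basis (b, c)) = \<alpha> (basis b) * \<beta> (basis c)"
  by (simp add: pairing_def)

lemma pairing_tensor:
  assumes "linear \<alpha>" "linear \<beta>"
  shows "pairing \<alpha> \<beta> (tensor v w) = \<alpha> v * \<beta> w"
proof -
  have 1: "pairing \<alpha> \<beta> (lin_ext (\<lambda>c. basis (b, c)) w) = \<alpha> (basis b) * \<beta> w" for b
  proof (rule linear_eq_on_basis[of "\<lambda>w. pairing \<alpha> \<beta> (lin_ext (\<lambda>c. basis (b, c)) w)" "\<lambda>w. \<alpha> (basis b) * \<beta> w"])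
    show "linear (\<lambda>w. pairing \<alpha> \<beta> (lin_ext (\<lambda>c. basis (b, c)) w))"
      using linear_compose[OF linear_lin_ext linear_pairing] by (simp add: o_def)
    show "linear (\<lambda>w. \<alpha> (basis b) * \<beta> w)"
      using assms(2) by (auto simp: linear_iff algebra_simps)
  qed simp
  show ?thesis
  proof (rule linear_eq_on_basis[of "\<lambda>v. pairing \<alpha> \<beta> (tensor v w)" "\<lambda>v. \<alpha> v * \<beta> w"])
    show "linear (\<lambda>v. pairing \<alpha> \<beta> (tensor v w))"
      unfolding tensor_def using linear_compose[OF linear_lin_ext linear_pairing] by (simp add: o_def)
    show "linear (\<lambda>v. \<alpha> v * \<beta> w)"
      using assms(1) by (auto simp: linear_iff algebra_simps)
    show "pairing \<alpha> \<beta> (tensor (basis b) w) = \<alpha> (basis b) * \<beta> w" for b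
      by (simp add: tensor_def 1)
  qed
qed

lemma pairing_tensor_map:
  assumes "linear \<alpha>" "linear \<beta>"
  shows "pairing \<alpha> \<beta> (tensor_map f g v) = pairing (\<alpha> \<circ> f) (\<beta> \<circ> g) v"
proof (rule linear_eq_on_basis[of "\<lambda>v. pairing \<alpha> \<beta> (tensor_map f g v)"])
  show "linear (\<lambda>v. pairing \<alpha> \<beta> (tensor_map f g v))"
    unfolding tensor_map_def using linear_compose[OF linear_lin_ext linear_pairing] by (simp add: o_def)
  show "linear (pairing (\<alpha> \<circ> f) (\<beta> \<circ> g))" by (rule linear_pairing)
  show "pairing \<alpha> \<beta> (tensor_map f g (basis b)) = pairing (\<alpha> \<circ> f) (\<beta> \<circ> g) (basis b)" for b
    by (cases b) (simp add: tensor_map_def pairing_tensor assms)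
qed

definition evaluate :: "real \<Rightarrow> (nat \<Rightarrow>\<^sub>0 real) \<Rightarrow> real" where
  "evaluate t p = poly (to_poly p) t"

lemma evaluate_eq_lin_ext: "evaluate t = lin_ext (\<lambda>n. t ^ n)"
  by (rule ext) (simp add: evaluate_def to_poly_def lin_ext_def poly_sum poly_monom)

lemma linear_evaluate: "linear (evaluate t)"
  unfolding evaluate_eq_lin_ext by (rule linear_lin_ext)

lemma evaluate_basis [simp]: "evaluate t (basis n) = t ^ n"
  by (simp add: evaluate_eq_lin_ext)

text \<open>
  Evaluation at \<open>(s, t)\<close> on \<open>\<real>[x] \<otimes> \<real>[x]\<close> is multiplicative, and it takes the value \<open>s + t\<close>
  at \<open>\<Delta> x = 1 \<otimes> x + x \<otimes> 1\<close>.
\<close>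

lemma pairing_mult_generator:
  "pairing (evaluate s) (evaluate t) ((tensor 1 (basis 1) + tensor (basis 1) 1) * q) =
   (s + t) * pairing (evaluate s) (evaluate t) q"
proof -
  have g: "tensor 1 (basis 1) + tensor (basis 1) 1 = (basis (0, 1) + basis (1, 0) :: nat \<times> nat \<Rightarrow>\<^sub>0 real)"
    by (simp flip: single_one)
  let ?E = "pairing (evaluate s) (evaluate t)"
  have scale: "a * (c *\<^sub>R b) = c *\<^sub>R (a * b)" for a b :: "nat \<times> nat \<Rightarrow>\<^sub>0 real" and c
  proof -
    have "c *\<^sub>R b = Poly_Mapping.single 0 c * b" for b :: "nat \<times> nat \<Rightarrow>\<^sub>0 real"
      by (rule poly_mapping_eqI) (simp flip: mult_map_scale_conv_mult add: map.rep_eq when_def)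
    then show ?thesis by (simp add: mult.left_commute)
  qed
  show ?thesis
    unfolding g
  proof (rule linear_eq_on_basis[of "\<lambda>q. ?E ((basis (0, 1) + basis (1, 0)) * q)" "\<lambda>q. (s + t) * ?E q"])
    have "linear (\<lambda>q. (basis (0, 1) + basis (1, 0)) * q :: nat \<times> nat \<Rightarrow>\<^sub>0 real)"
      by (rule linearI) (rule distrib_left, rule scale)
    then show "linear (\<lambda>q. ?E ((basis (0, 1) + basis (1, 0)) * q))"
      using linear_compose[OF _ linear_pairing] by (fastforce simp: o_def)
    show "linear (\<lambda>q. (s + t) * ?E q)"
      using linear_pairing[of "evaluate s" "evaluate t"] by (auto simp: linear_iff algebra_simps)
    fix b :: "nat \<times> nat"
    obtain i j where b: "b = (i, j)" by (cases b)
    show "?E ((basis (0, 1) + basis (1, 0)) * basis b) = (s + t) * ?E (basis b)"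
      using linear_add[OF linear_pairing[of "evaluate s" "evaluate t"]]
      by (simp add: b distrib_right mult_single algebra_simps)
  qed
qed

lemma pairing_Delta_poly:
  "pairing (evaluate s) (evaluate t) (Delta poly_double_bialgebra p) = evaluate (s + t) p"
proof (rule linear_eq_on_basis[of "\<lambda>p. pairing (evaluate s) (evaluate t) (Delta poly_double_bialgebra p)"])
  show "linear (\<lambda>p. pairing (evaluate s) (evaluate t) (Delta poly_double_bialgebra p))"
    using linear_compose[OF linear_lin_ext linear_pairing]
    by (simp add: o_def poly_double_bialgebra_def)
  show "linear (evaluate (s + t))" by (rule linear_evaluate)
  show "pairing (evaluate s) (evaluate t) (Delta poly_double_bialgebra (basis n)) = evaluate (s + t) (basis n)" for n
  proof -
    have "pairing (evaluate s) (evaluate t) ((tensor 1 (basis 1) + tensor (basis 1) 1) ^ n) = (s + t) ^ n"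
    proof (induction n)
      case 0
      have one: "(1 :: nat \<times> nat \<Rightarrow>\<^sub>0 real) = basis (0, 0)" by (simp flip: single_one zero_prod_def)
      have "pairing (evaluate s) (evaluate t) (basis (0, 0)) = 1"
        by (simp only: pairing_basis evaluate_basis power_0 mult_1)
      then show ?case by (metis one power_0)
    next
      case (Suc n)
      then show ?case unfolding power_Suc pairing_mult_generator by simp
    qed
    then show ?thesis by (simp add: poly_double_bialgebra_def)
  qed
qed

text \<open>
  A morphism turns the counits and the coproduct of polynomials into those of \<open>A\<close>. With \<open>s = 1\<close> the last equation computes \<open>\<theta>\<close> at natural numbers by recursion.
\<close>

lemma
  assumes "double_bialgebra_hom A poly_double_bialgebra \<theta>"
  shows evaluate_hom_0: "evaluate 0 (\<theta> v) = eps_Delta A v"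
    and evaluate_hom_1: "evaluate 1 (\<theta> v) = eps_delta A v"
    and evaluate_hom_add: "evaluate (s + t) (\<theta> v) = pairing (evaluate s \<circ> \<theta>) (evaluate t \<circ> \<theta>) (Delta A v)"
proof -
  show "evaluate 0 (\<theta> v) = eps_Delta A v" "evaluate 1 (\<theta> v) = eps_delta A v"
    using assms by (auto simp: double_bialgebra_hom_def poly_double_bialgebra_def evaluate_def)
  have "evaluate (s + t) (\<theta> v) = pairing (evaluate s) (evaluate t) (Delta poly_double_bialgebra (\<theta> v))"
    by (simp add: pairing_Delta_poly)
  also have "\<dots> = pairing (evaluate s) (evaluate t) (tensor_map \<theta> \<theta> (Delta A v))"
    using assms by (simp add: double_bialgebra_hom_def)
  also have "\<dots> = pairing (evaluate s \<circ> \<theta>) (evaluate t \<circ> \<theta>) (Delta A v)"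
    by (simp add: pairing_tensor_map linear_evaluate)
  finally show "evaluate (s + t) (\<theta> v) = pairing (evaluate s \<circ> \<theta>) (evaluate t \<circ> \<theta>) (Delta A v)" .
qed

section \<open>Isomorphism classes and their representatives\<close>

lemma iso_class_eqI:
  assumes "bij_betw \<sigma> J I" "\<And>A. A \<subseteq> J \<Longrightarrow> w A = u (\<sigma> ` A)"
  shows "iso_class J w = iso_class I u"
proof (intro equalityI subsetI)
  have inj: "inj_on \<sigma> J" and im: "\<sigma> ` J = I" using assms(1) by (auto simp: bij_betw_def)
  fix p
  show "p \<in> iso_class I u" if p: "p \<in> iso_class J w"
  proof -
    obtain n \<tau> where pn: "p = (n, restrict (\<lambda>A. w (\<tau> ` A)) (Pow {1..n}))" and \<tau>: "bij_betw \<tau> {1..n} J"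
      using p unfolding iso_class_def by blast
    have "w (\<tau> ` A) = u ((\<sigma> \<circ> \<tau>) ` A)" if "A \<subseteq> {1..n}" for A
    proof -
      have "\<tau> ` A \<subseteq> J" using \<tau> that by (auto simp: bij_betw_def)
      then show ?thesis using assms(2) by (simp add: image_comp)
    qed
    then have "p = (n, restrict (\<lambda>A. u ((\<sigma> \<circ> \<tau>) ` A)) (Pow {1..n}))"
      unfolding pn by (auto simp: restrict_def)
    moreover have "bij_betw (\<sigma> \<circ> \<tau>) {1..n} I" using bij_betw_trans[OF \<tau> assms(1)] .
    ultimately show ?thesis unfolding iso_class_def by blast
  qed
  show "p \<in> iso_class J w" if p: "p \<in> iso_class I u"
  proof -
    obtain n \<tau> where pn: "p = (n, restrict (\<lambda>A. u (\<tau> ` A)) (Pow {1..n}))" and \<tau>: "bij_betw \<tau> {1..n} I"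
      using p unfolding iso_class_def by blast
    define \<rho> where "\<rho> = inv_into J \<sigma> \<circ> \<tau>"
    have \<rho>: "bij_betw \<rho> {1..n} J"
      unfolding \<rho>_def using bij_betw_trans[OF \<tau> bij_betw_inv_into[OF assms(1)]] .
    have \<sigma>\<rho>: "\<sigma> (\<rho> i) = \<tau> i" if "i \<in> {1..n}" for i
      using bij_betwE[OF \<tau>] that by (simp add: \<rho>_def f_inv_into_f im)
    have "u (\<tau> ` A) = w (\<rho> ` A)" if "A \<subseteq> {1..n}" for A
    proof -
      have "\<rho> ` A \<subseteq> J" using \<rho> that by (auto simp: bij_betw_def)
      then have "w (\<rho> ` A) = u (\<sigma> ` \<rho> ` A)" by (rule assms(2))
      also have "\<sigma> ` \<rho> ` A = \<tau> ` A" unfolding image_image using \<sigma>\<rho> that by (intro image_cong) auto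
      finally show ?thesis by simp
    qed
    then have "p = (n, restrict (\<lambda>A. w (\<rho> ` A)) (Pow {1..n}))"
      unfolding pn by (auto simp: restrict_def)
    then show ?thesis unfolding iso_class_def using \<rho> by blast
  qed
qed

lemma submodular_on_transport:
  assumes "bij_betw \<sigma> J I" "submodular_on I u" "\<And>A. A \<subseteq> J \<Longrightarrow> w A = u (\<sigma> ` A)"
  shows "submodular_on J w"
proof -
  have inj: "inj_on \<sigma> J" and im: "\<sigma> ` J = I" using assms(1) by (auto simp: bij_betw_def)
  have sub: "\<sigma> ` A \<subseteq> I" if "A \<subseteq> J" for A using that im by auto
  show ?thesis
    unfolding submodular_on_def
  proof (intro conjI allI impI)
    fix A B assume AB: "A \<subseteq> J" "B \<subseteq> J"
    have "w (A \<union> B) = u (\<sigma> ` A \<union> \<sigma> ` B)" "w (A \<inter> B) = u (\<sigma> ` A \<inter> \<sigma> ` B)"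
      using AB assms(3)[of "A \<union> B"] assms(3)[of "A \<inter> B"] inj
      by (auto simp: image_Un inj_on_image_Int)
    then show "w (A \<union> B) + w (A \<inter> B) \<le> w A + w B"
      using AB assms sub by (simp add: submodular_on_def)
  qed (use assms sub im in \<open>auto simp: submodular_on_def\<close>)
qed

lemma modular_on_transport:
  assumes "bij_betw \<sigma> J I" "modular_on I u" "\<And>A. A \<subseteq> J \<Longrightarrow> w A = u (\<sigma> ` A)"
  shows "modular_on J w"
proof -
  have inj: "inj_on \<sigma> J" and im: "\<sigma> ` J = I" using assms(1) by (auto simp: bij_betw_def)
  have sub: "\<sigma> ` A \<subseteq> I" if "A \<subseteq> J" for A using that im by auto
  have "submodular_on J w"
    using assms by (intro submodular_on_transport[of \<sigma> J I u w]) (auto simp: modular_on_def)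
  moreover have "w (A \<union> B) + w (A \<inter> B) = w A + w B"
    if AB: "A \<subseteq> J" "B \<subseteq> J" "w A < \<infinity>" "w B < \<infinity>" for A B
  proof -
    have "w (A \<union> B) = u (\<sigma> ` A \<union> \<sigma> ` B)" "w (A \<inter> B) = u (\<sigma> ` A \<inter> \<sigma> ` B)"
      using AB assms(3)[of "A \<union> B"] assms(3)[of "A \<inter> B"] inj
      by (auto simp: image_Un inj_on_image_Int)
    then show ?thesis
      using AB assms sub by (simp add: modular_on_def)
  qed
  ultimately show ?thesis by (simp add: modular_on_def)
qed

lemma iso_class_nonempty:
  assumes "finite I"
  shows "iso_class I u \<noteq> {}"
  using ex_bij_betw_nat_finite_1[OF assms] by (auto simp: iso_class_def)

lemma iso_class_standard:
  assumes "finite I"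
  shows "\<exists>n \<sigma>. bij_betw \<sigma> {1..n::nat} I \<and> iso_class I u = iso_class {1..n} (\<lambda>A. u (\<sigma> ` A))"
  using ex_bij_betw_nat_finite_1[OF assms] iso_class_eqI[of _ "{1.._}" I "\<lambda>A. u (_ ` A)" u] by metis

lemma iso_class_memD:
  assumes "(n, w) \<in> iso_class I u"
  shows "\<exists>\<sigma>. bij_betw \<sigma> {1..n} I \<and> (\<forall>A\<subseteq>{1..n}. w A = u (\<sigma> ` A))"
  using assms by (auto simp: iso_class_def)

text \<open>
  The choice of representative in \<open>on_mod\<close> only guarantees a function isomorphic to \<open>u\<close>, so the
  result is \<open>F I u\<close> when \<open>F\<close> is invariant under isomorphism.
\<close>

lemma on_mod_mod_vec:
  assumes "finite I" "modular_on I u"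
  obtains \<sigma> n w where "bij_betw \<sigma> {1..n} I" "\<forall>A\<subseteq>{1..n}. w A = u (\<sigma> ` A)"
    "on_mod F (mod_vec I u) = F {1..n} w"
proof -
  let ?c = "Abs_modular_class (iso_class I u)"
  obtain m \<tau> where \<tau>: "bij_betw \<tau> {1..m::nat} I" "iso_class I u = iso_class {1..m} (\<lambda>A. u (\<tau> ` A))"
    using iso_class_standard[OF assms(1)] by blast
  have "modular_on {1..m} (\<lambda>A. u (\<tau> ` A))"
    by (rule modular_on_transport[OF \<tau>(1) assms(2)]) simp
  then have R: "Rep_modular_class ?c = iso_class I u"
    using \<tau>(2) by (intro Abs_modular_class_inverse) blast
  obtain n w where nw: "mod_rep ?c = (n, w)" by (cases "mod_rep ?c")
  have "mod_rep ?c \<in> iso_class I u"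
    unfolding mod_rep_def R using iso_class_nonempty[OF assms(1)] by (meson all_not_in_conv someI)
  then obtain \<sigma> where "bij_betw \<sigma> {1..n} I" "\<forall>A\<subseteq>{1..n}. w A = u (\<sigma> ` A)"
    using iso_class_memD[of n w I u] nw by auto
  moreover have "on_mod F (mod_vec I u) = F {1..n} w"
    by (simp add: on_mod_def mod_vec_def nw)
  ultimately show thesis using that by blast
qed

lemma on_sm_sm_vec:
  assumes "finite I" "submodular_on I u"
  obtains \<sigma> n w where "bij_betw \<sigma> {1..n} I" "\<forall>A\<subseteq>{1..n}. w A = u (\<sigma> ` A)"
    "on_sm F (sm_vec I u) = F {1..n} w"
proof -
  let ?c = "Abs_submodular_class (iso_class I u)"
  obtain m \<tau> where \<tau>: "bij_betw \<tau> {1..m::nat} I" "iso_class I u = iso_class {1..m} (\<lambda>A. u (\<tau> ` A))"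
    using iso_class_standard[OF assms(1)] by blast
  have "submodular_on {1..m} (\<lambda>A. u (\<tau> ` A))"
    by (rule submodular_on_transport[OF \<tau>(1) assms(2)]) simp
  then have R: "Rep_submodular_class ?c = iso_class I u"
    using \<tau>(2) by (intro Abs_submodular_class_inverse) blast
  obtain n w where nw: "sm_rep ?c = (n, w)" by (cases "sm_rep ?c")
  have "sm_rep ?c \<in> iso_class I u"
    unfolding sm_rep_def R using iso_class_nonempty[OF assms(1)] by (meson all_not_in_conv someI)
  then obtain \<sigma> where "bij_betw \<sigma> {1..n} I" "\<forall>A\<subseteq>{1..n}. w A = u (\<sigma> ` A)"
    using iso_class_memD[of n w I u] nw by auto
  moreover have "on_sm F (sm_vec I u) = F {1..n} w"
    by (simp add: on_sm_def sm_vec_def nw)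
  ultimately show thesis using that by blast
qed

lemma mod_vec_eqI:
  assumes "bij_betw \<sigma> J I" "\<And>A. A \<subseteq> J \<Longrightarrow> w A = u (\<sigma> ` A)"
  shows "mod_vec J w = mod_vec I u"
  using iso_class_eqI[of \<sigma> J I w u] assms by (simp add: mod_vec_def)

section \<open>Values of the morphism on functions supported on down-sets\<close>

text \<open>
  For \<open>P\<close> the preorder of a vertex \<open>x\<close> this is \<open>z\<^sup>P\<close>. Unlike \<open>z\<^sup>P\<close>, the form with \<open>x\<close> is
  visibly stable under restriction to and contraction by down-sets.
\<close>

definition on_downsets :: "'a set \<Rightarrow> 'a rel \<Rightarrow> ('a \<Rightarrow> real) \<Rightarrow> 'a set \<Rightarrow> ereal" where
  "on_downsets I P x A = (if downset I P A then ereal (sum x A) else \<infinity>)"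

lemma modular_on_downsets:
  assumes "finite I" "P \<subseteq> I \<times> I"
  shows "modular_on I (on_downsets I P x)"
proof -
  have eq: "on_downsets I P x (A \<union> B) + on_downsets I P x (A \<inter> B) = on_downsets I P x A + on_downsets I P x B"
    if "downset I P A" "downset I P B" for A B
  proof -
    have "downset I P (A \<union> B)" "downset I P (A \<inter> B)" using that unfolding downset_def by blast+
    moreover have "finite A" "finite B" using that assms(1) finite_subset unfolding downset_def by blast+
    then have "sum x (A \<union> B) + sum x (A \<inter> B) = sum x A + sum x B" by (rule sum.union_inter)
    ultimately show ?thesis using that by (simp add: on_downsets_def)
  qed
  have inf: "on_downsets I P x A < \<infinity> \<longleftrightarrow> downset I P A" for A by (simp add: on_downsets_def)
  have "downset I P {}" "downset I P I" using assms(2) by (auto simp: downset_def)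
  moreover have "on_downsets I P x (A \<union> B) + on_downsets I P x (A \<inter> B) \<le> on_downsets I P x A + on_downsets I P x B" for A B
  proof (cases "downset I P A \<and> downset I P B")
    case True
    then show ?thesis using eq by simp
  next
    case False
    then have "on_downsets I P x A + on_downsets I P x B = \<infinity>" by (auto simp: on_downsets_def)
    then show ?thesis by (simp only: ereal_less_eq(1))
  qed
  ultimately show ?thesis
    unfolding modular_on_def submodular_on_def inf using eq by (auto simp: on_downsets_def)
qed

abbreviation downset_vec :: "'a set \<Rightarrow> 'a rel \<Rightarrow> ('a \<Rightarrow> real) \<Rightarrow> MOD" where
  "downset_vec I P x \<equiv> mod_vec I (on_downsets I P x)"

lemma eps_Delta_downset_vec:
  assumes "finite I" "preorder_on I P"
  shows "eps_Delta MOD_double_bialgebra (downset_vec I P x) = of_bool (I = {})"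
proof -
  have PI: "P \<subseteq> I \<times> I" using assms by (simp add: preorder_on_def)
  let ?F = "\<lambda>(I :: nat set) (z :: nat set \<Rightarrow> ereal). if I = {} then 1 else 0 :: real"
  obtain \<sigma> n w where "bij_betw \<sigma> {1..n} I" "\<forall>A\<subseteq>{1..n}. w A = on_downsets I P x (\<sigma> ` A)"
    and eq: "on_mod ?F (downset_vec I P x) = ?F {1..n} w"
    by (rule on_mod_mod_vec[OF assms(1) modular_on_downsets[OF assms(1) PI, of x], where F = ?F])
  then have "{1..n} = {} \<longleftrightarrow> I = {}" by (metis bij_betw_def image_is_empty)
  then show ?thesis using eq by (simp add: MOD_double_bialgebra_def)
qed

lemma pre_eqI:
  assumes "preorder_on I P" "\<And>A. A \<subseteq> I \<Longrightarrow> z A < \<infinity> \<longleftrightarrow> downset I P A"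
  shows "pre I z = P"
  unfolding pre_def
proof (rule the_equality)
  show "preorder_on I P \<and> (\<forall>A\<subseteq>I. downset I P A \<longleftrightarrow> z A < \<infinity>)" using assms by blast
  fix Q assume Q: "preorder_on I Q \<and> (\<forall>A\<subseteq>I. downset I Q A \<longleftrightarrow> z A < \<infinity>)"
  then have "downset I P A \<longleftrightarrow> downset I Q A" for A
    using assms(2) by (meson downset_def)
  then show "Q = P" using subset_of_downsets[of I P Q] subset_of_downsets[of I Q P] assms(1) Q by blast
qed

text \<open>
  The representative lives on \<open>{1..n}\<close>; its preorder \<open>Q\<close> is the preimage of \<open>P\<close>.
\<close>

lemma eps_delta_downset_vec:
  assumes "finite I" "preorder_on I P"
  shows "eps_delta MOD_double_bialgebra (downset_vec I P x) = of_bool (equiv I P)"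
proof -
  let ?F = "\<lambda>(I :: nat set) (z :: nat set \<Rightarrow> ereal). if equiv I (pre I z) then 1 else 0 :: real"
  have PI: "P \<subseteq> I \<times> I" using assms by (simp add: preorder_on_def)
  obtain \<sigma> n w where \<sigma>: "bij_betw \<sigma> {1..n} I"
    and w': "\<forall>A\<subseteq>{1..n}. w A = on_downsets I P x (\<sigma> ` A)"
    and eq: "on_mod ?F (downset_vec I P x) = ?F {1..n} w"
    by (rule on_mod_mod_vec[OF assms(1) modular_on_downsets[OF assms(1) PI, of x], where F = ?F])
  note w = w'[rule_format]
  let ?J = "{1..n}"
  have inj: "inj_on \<sigma> ?J" and im: "\<sigma> ` ?J = I" using \<sigma> by (auto simp: bij_betw_def)
  define Q where "Q = {(i, j). i \<in> ?J \<and> j \<in> ?J \<and> (\<sigma> i, \<sigma> j) \<in> P}"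
  have pQ: "preorder_on ?J Q"
    unfolding preorder_on_def
  proof (intro conjI)
    show "Q \<subseteq> ?J \<times> ?J" by (auto simp: Q_def)
    have "(a, a) \<in> P" if "a \<in> I" for a using assms that by (auto simp: preorder_on_def refl_on_def)
    then show "refl_on ?J Q" using im by (auto simp: Q_def refl_on_def)
    have "trans P" using assms by (simp add: preorder_on_def)
    then show "trans Q" unfolding trans_def Q_def by blast
  qed
  have down: "downset ?J Q A \<longleftrightarrow> downset I P (\<sigma> ` A)" if A: "A \<subseteq> ?J" for A
  proof
    assume d: "downset I P (\<sigma> ` A)"
    have "i \<in> A" if "(i, j) \<in> Q" "j \<in> A" for i j
    proof -
      have "\<sigma> i \<in> \<sigma> ` A" using d that unfolding downset_def Q_def by blast
      then show ?thesis using inj A that by (auto simp: Q_def inj_on_image_mem_iff)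
    qed
    then show "downset ?J Q A" using A unfolding downset_def by blast
  next
    assume d: "downset ?J Q A"
    have "a \<in> \<sigma> ` A" if ab: "(a, \<sigma> j) \<in> P" "j \<in> A" for a j
    proof -
      obtain i where "i \<in> ?J" "a = \<sigma> i" using ab PI im by blast
      then show ?thesis using d ab A unfolding downset_def Q_def by blast
    qed
    then show "downset I P (\<sigma> ` A)" using A im unfolding downset_def by blast
  qed
  have "pre ?J w = Q"
    using pQ w down by (intro pre_eqI) (auto simp: on_downsets_def)
  moreover have "equiv ?J Q \<longleftrightarrow> equiv I P"
  proof -
    have "sym Q \<longleftrightarrow> sym P"
    proof
      assume s: "sym Q"
      show "sym P"
      proof (rule symI)
        fix a b assume ab: "(a, b) \<in> P"
        then obtain i j where "i \<in> ?J" "a = \<sigma> i" "j \<in> ?J" "b = \<sigma> j" using PI im by blast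
        then show "(b, a) \<in> P" using s ab unfolding sym_def Q_def by blast
      qed
    qed (auto simp: sym_def Q_def)
    then show ?thesis using pQ assms(2) by (auto simp: equiv_def preorder_on_def)
  qed
  ultimately show ?thesis using eq by (simp add: MOD_double_bialgebra_def)
qed

text \<open>
  The restriction and the contraction at a down-set \<open>S\<close> of \<open>on_downsets I P x\<close> are the functions of
  the same kind for the restrictions of \<open>P\<close>; all other \<open>S\<close> have the value \<open>\<infinity>\<close>.
\<close>

lemma Delta_downset_vec:
  assumes "finite I" "preorder_on I P"
  shows "Delta MOD_double_bialgebra (downset_vec I P x) =
    (\<Sum>S\<in>Pow I. if downset I P S
      then tensor (downset_vec S (Restr P S) x) (downset_vec (I - S) (Restr P (I - S)) x) else 0)"
proof -
  let ?F = "\<lambda>(I :: nat set) (z :: nat set \<Rightarrow> ereal). \<Sum>S\<in>Pow I.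
       if z S < \<infinity> then tensor (mod_vec S z) (mod_vec (I - S) (contract z S)) else 0"
  have PI: "P \<subseteq> I \<times> I" using assms by (simp add: preorder_on_def)
  obtain \<sigma> n w where \<sigma>: "bij_betw \<sigma> {1..n} I"
    and w': "\<forall>A\<subseteq>{1..n}. w A = on_downsets I P x (\<sigma> ` A)"
    and eq: "on_mod ?F (downset_vec I P x) = ?F {1..n} w"
    by (rule on_mod_mod_vec[OF assms(1) modular_on_downsets[OF assms(1) PI, of x], where F = ?F])
  note w = w'[rule_format]
  let ?J = "{1..n}"
  let ?T = "\<lambda>S. if downset I P S
      then tensor (downset_vec S (Restr P S) x) (downset_vec (I - S) (Restr P (I - S)) x) else 0"
  have inj: "inj_on \<sigma> ?J" and im: "\<sigma> ` ?J = I" using \<sigma> by (auto simp: bij_betw_def)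
  have term_eq: "(if w S < \<infinity> then tensor (mod_vec S w) (mod_vec (?J - S) (contract w S)) else 0) = ?T (\<sigma> ` S)"
    if S: "S \<subseteq> ?J" for S
  proof (cases "downset I P (\<sigma> ` S)")
    case False
    then show ?thesis using w[OF S] by (simp add: on_downsets_def)
  next
    case True
    have b: "bij_betw \<sigma> S (\<sigma> ` S)" "bij_betw \<sigma> (?J - S) (I - \<sigma> ` S)"
      using inj im S by (auto simp: bij_betw_def inj_on_image_set_diff intro: inj_on_subset)
    have "mod_vec S w = downset_vec (\<sigma> ` S) (Restr P (\<sigma> ` S)) x"
    proof (rule mod_vec_eqI[OF b(1)])
      fix A assume A: "A \<subseteq> S"
      then have "w A = on_downsets I P x (\<sigma> ` A)" using S by (intro w) auto
      then show "w A = on_downsets (\<sigma> ` S) (Restr P (\<sigma> ` S)) x (\<sigma> ` A)"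
        using downset_restriction[OF True, of "\<sigma> ` A"] A by (simp add: on_downsets_def image_mono)
    qed
    moreover have "mod_vec (?J - S) (contract w S) = downset_vec (I - \<sigma> ` S) (Restr P (I - \<sigma> ` S)) x"
    proof (rule mod_vec_eqI[OF b(2)])
      fix A assume A: "A \<subseteq> ?J - S"
      have sub: "\<sigma> ` A \<subseteq> I - \<sigma> ` S" using b(2) A by (auto simp: bij_betw_def)
      have "w (S \<union> A) = on_downsets I P x (\<sigma> ` S \<union> \<sigma> ` A)"
        using w[of "S \<union> A"] S A by (auto simp: image_Un)
      moreover have "w S = ereal (sum x (\<sigma> ` S))" using w[OF S] True by (simp add: on_downsets_def)
      moreover have "sum x (\<sigma> ` S \<union> \<sigma> ` A) = sum x (\<sigma> ` S) + sum x (\<sigma> ` A)"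
        using S A sub by (intro sum.union_disjoint) (auto intro: finite_subset)
      ultimately show "contract w S A = on_downsets (I - \<sigma> ` S) (Restr P (I - \<sigma> ` S)) x (\<sigma> ` A)"
        using downset_contraction[OF PI True sub] by (simp add: contract_def on_downsets_def)
    qed
    ultimately show ?thesis using True w[OF S] by (simp add: on_downsets_def)
  qed
  have "bij_betw ((`) \<sigma>) (Pow ?J) (Pow I)"
    using inj im by (simp add: bij_betw_def inj_on_image_Pow image_Pow_surj)
  then have "?F ?J w = (\<Sum>S\<in>Pow I. ?T S)"
    using term_eq by (subst sum.reindex_bij_betw[symmetric]) (auto intro: sum.cong)
  then show ?thesis using eq by (simp add: MOD_double_bialgebra_def)
qed

text \<open>
  The coproduct splits off the first block of a decomposition, on which evaluation at \<open>1\<close>, being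
  \<open>\<epsilon>\<^sub>\<delta>\<close>, tests whether the restriction of \<open>P\<close> is an equivalence relation.
\<close>

lemma evaluate_downset_vec:
  assumes \<theta>: "double_bialgebra_hom MOD_double_bialgebra poly_double_bialgebra \<theta>"
    and "finite I" "preorder_on I P"
  shows "evaluate (real n) (\<theta> (downset_vec I P x)) =
    (\<Sum>Ss\<in>ordered_decompositions I n. of_bool (graded_by Ss I P))"
  using assms(2,3)
proof (induction n arbitrary: I P)
  case 0
  have "evaluate (real 0) (\<theta> (downset_vec I P x)) = of_bool (I = {})"
    using evaluate_hom_0[OF \<theta>] eps_Delta_downset_vec[OF 0] by simp
  then show ?case by (cases "I = {}") (simp_all add: ordered_decompositions_0)
next
  case (Suc n)
  have lin: "linear (evaluate t \<circ> \<theta>)" for t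
    using \<theta> linear_compose linear_evaluate by (auto simp: double_bialgebra_hom_def)
  let ?p = "pairing (evaluate 1 \<circ> \<theta>) (evaluate (real n) \<circ> \<theta>)"
  have "evaluate (real (Suc n)) (\<theta> (downset_vec I P x)) = ?p (Delta MOD_double_bialgebra (downset_vec I P x))"
    using evaluate_hom_add[OF \<theta>, of 1 "real n"] by simp
  also have "\<dots> = (\<Sum>S\<in>Pow I. if downset I P S then
      ?p (tensor (downset_vec S (Restr P S) x) (downset_vec (I - S) (Restr P (I - S)) x)) else 0)"
    unfolding Delta_downset_vec[OF Suc.prems] linear_sum[OF linear_pairing]
    by (intro sum.cong) (auto simp: linear_0[OF linear_pairing])
  also have "\<dots> = (\<Sum>S\<in>Pow I. \<Sum>Ss\<in>ordered_decompositions (I - S) n. of_bool (graded_by (S # Ss) I P))"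
  proof (intro sum.cong refl)
    fix S assume "S \<in> Pow I"
    then have S: "S \<subseteq> I" "finite S" using Suc.prems finite_subset by auto
    have pre: "preorder_on S (Restr P S)" "preorder_on (I - S) (Restr P (I - S))"
      using Suc.prems(2) S by (auto intro: preorder_on_Restr)
    have 1: "evaluate 1 (\<theta> (downset_vec S (Restr P S) x)) = of_bool (equiv S (Restr P S))"
      using evaluate_hom_1[OF \<theta>] eps_delta_downset_vec[OF S(2) pre(1)] by simp
    have 2: "evaluate (real n) (\<theta> (downset_vec (I - S) (Restr P (I - S)) x)) =
        (\<Sum>Ss\<in>ordered_decompositions (I - S) n. of_bool (graded_by Ss (I - S) (Restr P (I - S))))"
      using Suc.IH[OF _ pre(2)] Suc.prems(1) by simp
    show "(if downset I P S then
        ?p (tensor (downset_vec S (Restr P S) x) (downset_vec (I - S) (Restr P (I - S)) x)) else 0) =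
      (\<Sum>Ss\<in>ordered_decompositions (I - S) n. of_bool (graded_by (S # Ss) I P))"
    proof (cases "downset I P S")
      case True
      have "?p (tensor (downset_vec S (Restr P S) x) (downset_vec (I - S) (Restr P (I - S)) x)) =
          of_bool (equiv S (Restr P S)) *
          (\<Sum>Ss\<in>ordered_decompositions (I - S) n. of_bool (graded_by Ss (I - S) (Restr P (I - S))))"
        by (simp only: pairing_tensor[OF lin lin] o_apply 1 2)
      then show ?thesis using True by (simp only: graded_by.simps if_True simp_thms of_bool_conj sum_distrib_left)
    qed simp
  qed
  also have "\<dots> = (\<Sum>Ss\<in>ordered_decompositions I (Suc n). of_bool (graded_by Ss I P))"
    by (rule sum_ordered_decompositions_Suc[OF Suc.prems(1), symmetric])
  finally show ?case .
qed

lemma (in finite_submodular) evaluate_sum_minPre: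
  assumes \<theta>: "double_bialgebra_hom MOD_double_bialgebra poly_double_bialgebra \<theta>"
  shows "evaluate (real n) (\<theta> (\<Sum>P\<in>minPre I z. mod_vec I (downset_restrict I z P))) =
    (\<Sum>Ss\<in>ordered_decompositions I n. basic_on_coproduct Ss z)"
proof -
  have vec: "mod_vec I (downset_restrict I z (tight_preorder x)) = downset_vec I (tight_preorder x) x"
    if "x \<in> vertices" for x
  proof (rule mod_vec_eqI[of id])
    fix A assume "A \<subseteq> I"
    then show "downset_restrict I z (tight_preorder x) A = on_downsets I (tight_preorder x) x (id ` A)"
      using that downset_tight_preorder[of x A] val[of A]
      by (simp add: vertices_def downset_restrict_def on_downsets_def tight_def)
  qed simp
  have "linear \<theta>" using \<theta> by (simp add: double_bialgebra_hom_def)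
  then have "evaluate (real n) (\<theta> (\<Sum>P\<in>minPre I z. mod_vec I (downset_restrict I z P))) =
      (\<Sum>P\<in>minPre I z. evaluate (real n) (\<theta> (mod_vec I (downset_restrict I z P))))"
    by (simp add: linear_sum linear_evaluate)
  also have "\<dots> = (\<Sum>x\<in>vertices. evaluate (real n) (\<theta> (downset_vec I (tight_preorder x) x)))"
    using vec by (subst sum.reindex_bij_betw[OF bij_betw_vertices_minPre, symmetric]) simp
  also have "\<dots> = (\<Sum>x\<in>vertices. \<Sum>Ss\<in>ordered_decompositions I n. of_bool (graded_by Ss I (tight_preorder x)))"
    using evaluate_downset_vec[OF \<theta> finite_ground preorder_tight_preorder] by simp
  also have "\<dots> = (\<Sum>Ss\<in>ordered_decompositions I n. basic_on_coproduct Ss z)"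
    by (rule sum_vertices_graded_by)
  finally show ?thesis .
qed

lemma poly_eqI_nat:
  fixes p q :: "real poly"
  assumes "\<And>n::nat. poly p (of_nat n) = poly q (of_nat n)"
  shows "p = q"
proof (rule ccontr)
  assume "p \<noteq> q"
  then have "finite {t. poly (p - q) t = 0}" by (intro poly_roots_finite) simp
  moreover have "range (of_nat :: nat \<Rightarrow> real) \<subseteq> {t. poly (p - q) t = 0}" using assms by auto
  ultimately have "finite (range (of_nat :: nat \<Rightarrow> real))" using finite_subset by blast
  then show False by (simp add: finite_image_iff inj_of_nat)
qed

theorem proposition13p7:
  fixes I :: "'a set" and z :: "'a set \<Rightarrow> ereal"
    and \<theta> :: "MOD \<Rightarrow> (nat \<Rightarrow>\<^sub>0 real)" and k :: real
  assumes "finite I"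
    and "submodular_on I z"
    and "finite_valued I z"
    and "double_bialgebra_hom MOD_double_bialgebra poly_double_bialgebra \<theta>"
  shows "poly (to_poly (\<theta> (phi_bar (sm_vec I z)))) k = poly (chi_AA I z) k"
proof -
  let ?p = "to_poly (\<theta> (phi_bar (sm_vec I z)))"
  let ?F = "\<lambda>(I :: nat set) (z :: nat set \<Rightarrow> ereal). \<Sum>P\<in>minPre I z. mod_vec I (downset_restrict I z P)"
  obtain \<sigma> n w where \<sigma>: "bij_betw \<sigma> {1..n} I"
    and w': "\<forall>A\<subseteq>{1..n}. w A = z (\<sigma> ` A)"
    and phi: "phi_bar (sm_vec I z) = ?F {1..n} w"
    unfolding phi_bar_def by (rule on_sm_sm_vec[OF assms(1,2), where F = ?F])
  note w = w'[rule_format]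
  have z: "finite_submodular I z (\<lambda>A. real_of_ereal (z A))"
    using assms(1-3) by (rule finite_submodular_real_of_ereal)
  have "finite_valued {1..n} w"
  proof -
    have "\<sigma> ` A \<subseteq> I" if "A \<subseteq> {1..n}" for A using \<sigma> that by (auto simp: bij_betw_def)
    then show ?thesis using assms(3) w by (simp add: finite_valued_def)
  qed
  then have fw: "finite_submodular {1..n} w (\<lambda>A. real_of_ereal (w A))"
    using submodular_on_transport[OF \<sigma> assms(2) w] by (intro finite_submodular_real_of_ereal) auto
  have val: "poly ?p (of_nat m) = (\<Sum>Ss\<in>ordered_decompositions I m. basic_on_coproduct Ss z)" for m
    using finite_submodular.evaluate_sum_minPre[OF fw assms(4), of m]
      sum_basic_on_coproduct_transport[OF z fw \<sigma> w, of m]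
    unfolding phi evaluate_def by simp
  have "chi_AA I z = ?p"
    unfolding chi_AA_def
  proof (rule the_equality)
    show "\<forall>m::nat. poly ?p (of_nat m) = (\<Sum>Ss\<in>ordered_decompositions I m. basic_on_coproduct Ss z)"
      using val by blast
    show "q = ?p" if "\<forall>m::nat. poly q (of_nat m) =
        (\<Sum>Ss\<in>ordered_decompositions I m. basic_on_coproduct Ss z)" for q
      using that val by (intro poly_eqI_nat) simp
  qed
  then show ?thesis by simp
qed

end
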